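(* Let $A$ be a finite-dimensional vector space, $(A,\dashv,\vdash)$ a Novikov dialgebra, and $\bar A=\mathbf{k}[\partial]A$ the Leibniz conformal algebra corresponding to $(A,\dashv,\vdash)$. Suppose that $\delta$ and $\Delta$ are two $\mathbf{k}[\partial]$-module homomorphisms from $\bar A$ to $\bar A\otimes\bar A$ such that $\delta(A)\subset A\otimes A$ and $\Delta(A)\subset A\otimes A$. Let $\alpha:\bar A\to\bar A\otimes\bar A$ be the $\mathbf{k}[\partial]$-module homomorphism with $$\alpha(a)=(\partial\otimes\mathrm{id})\Delta(a)-\tau(\partial\otimes\mathrm{id})\delta(a)\quad\text{for all }a\in A.$$ Then $(\bar A,[\cdot_\lambda\cdot],\alpha)$ is a Leibniz conformal bialgebra if and only if $(A,\dashv,\vdash,\delta,\Delta)$ is a Novikov bi-dialgebra.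
   Context: $\mathbf{k}$ is a field of characteristic zero; tensors are over $\mathbf{k}$; $\tau(a\otimes b)=b\otimes a$, $\tau_{12}=\tau\otimes\mathrm{id}$, $\tau_{23}=\mathrm{id}\otimes\tau$; $\partial$ acts on a tensor square by $\partial^{\otimes^2}=\partial\otimes\mathrm{id}+\mathrm{id}\otimes\partial$. Novikov dialgebra $(A,\dashv,\vdash)$: for all $a,b,c$: $(a\vdash b)\dashv c=(a\vdash c)\vdash b=(a\dashv c)\vdash b$; $a\dashv(b\dashv c)=a\dashv(b\vdash c)$; $(a\dashv b)\dashv c=(a\dashv c)\dashv b$; $(a\dashv b)\dashv c-a\dashv(b\dashv c)=(b\vdash a)\dashv c-b\vdash(a\dashv c)$; $(a\vdash b)\vdash c-a\vdash(b\vdash c)=(b\vdash a)\vdash c-b\vdash(a\vdash c)$. Corresponding Leibniz conformal algebra: $\bar A=\mathbf{k}[\partial]\otimes A$ with $[a_\lambda b]=\partial(b\dashv a)+\lambda(a\vdash b+b\dashv a)$ for $a,b\in A$, extended by $[\partial a_\lambda b]=-\lambda[a_\lambda b]$, $[a_\lambda\partial b]=(\lambda+\partial)[a_\lambda b]$. Operators: $L_\dashv(a)b=a\dashv b=R_\dashv(b)a$, $L_\vdash(a)b=a\vdash b=R_\vdash(b)a$, $L_\star(a)b=a\star b:=-a\dashv b-b\vdash a+a\vdash b+b\dashv a$. Novikov co-dialgebra $(A,\delta,\Delta)$: linear maps $\delta,\Delta:A\to A\otimes A$ with, for all $a$: $(\delta\otimes\mathrm{id})\delta(a)=\tau_{23}(\delta\otimes\mathrm{id})\delta(a)$;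 $(\Delta\otimes\mathrm{id})\delta(a)=\tau_{23}(\Delta\otimes\mathrm{id})\Delta(a)=\tau_{23}(\delta\otimes\mathrm{id})\Delta(a)$; $(\mathrm{id}\otimes\delta)\delta(a)=(\mathrm{id}\otimes\Delta)\delta(a)$; $(\delta\otimes\mathrm{id}-\mathrm{id}\otimes\delta)\delta(a)=\tau_{12}((\Delta\otimes\mathrm{id})\delta(a)-(\mathrm{id}\otimes\delta)\Delta(a))$; $(\Delta\otimes\mathrm{id}-\mathrm{id}\otimes\Delta)\Delta(a)=\tau_{12}(\Delta\otimes\mathrm{id}-\mathrm{id}\otimes\Delta)\Delta(a)$. Novikov bi-dialgebra $(A,\dashv,\vdash,\delta,\Delta)$: a Novikov dialgebra $(A,\dashv,\vdash)$ and a Novikov co-dialgebra $(A,\delta,\Delta)$ (here with $\delta,\Delta$ restricted to $A$) such that for all $a,b\in A$: (1) $(L_\dashv(a)\otimes\mathrm{id})\Delta(b)=-(\mathrm{id}\otimes(L_\dashv+R_\vdash)(b))\delta(a)$; (2) $(\mathrm{id}\otimes L_\dashv(b))\delta(a)=(L_\dashv(a)\otimes\mathrm{id})\tau\delta(b)$; (3) $(\mathrm{id}\otimes(L_\dashv+R_\vdash)(a))(\delta(b)+\tau\Delta(b))=(R_\vdash(b)\otimes\mathrm{id})\Delta(a)$; (4) $\delta(a\dashv b)=(R_\dashv(b)\otimes\mathrm{id})\delta(a)+(\mathrm{id}\otimes L_\star(a))(\mathrm{id}-\tau)(\delta(b)-\Delta(b))$; (5) $\delta(a\vdash b)=(R_\vdash(b)\otimes\mathrm{id})(\delta(a)-\Delta(a))+(\mathrm{id}\otimes(L_\vdash+R_\dashv)(a))(\delta(b)+\tau\Delta(b))$;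 (6) $\Delta(a\dashv b)=(\mathrm{id}\otimes(L_\dashv+R_\vdash)(a))(\mathrm{id}-\tau)(\Delta(b)-\delta(b))+(R_\dashv(b)\otimes\mathrm{id})\Delta(a)$; (7) $\Delta(a\vdash b)=((R_\vdash-R_\dashv)(b)\otimes\mathrm{id})(\delta(a)-\Delta(a))+(\mathrm{id}\otimes(L_\vdash+R_\dashv)(a))(\tau\delta(b)+\Delta(b))$; (8) $((L_\dashv+R_\vdash)(b)\otimes\mathrm{id})(\delta(a)-\Delta(a))+(\mathrm{id}\otimes L_\star(b))\tau(\delta(a)-\Delta(a))-((L_\vdash+R_\dashv)(a)\otimes\mathrm{id})\delta(b)+(\mathrm{id}\otimes(L_\vdash+R_\dashv)(a))\tau\Delta(b)=0$; (9) $(\mathrm{id}\otimes R_\vdash(a))(\mathrm{id}-\tau)(\delta(b)-\Delta(b))-(R_\dashv(b)\otimes\mathrm{id})(\Delta(a)+\tau\delta(a))=-(\mathrm{id}\otimes R_\dashv(b))(\Delta(a)+\tau\delta(a))+((R_\vdash-R_\dashv)(a)\otimes\mathrm{id})(\mathrm{id}-\tau)(\Delta(b)-\delta(b))$. Leibniz conformal bialgebra $(Q,[\cdot_\lambda\cdot],\alpha)$: $Q$ is a Leibniz conformal algebra (a $\mathbf{k}[\partial]$-module with $\mathbf{k}$-bilinear $[\cdot_\lambda\cdot]:Q\times Q\to Q[\lambda]$ satisfying the two sesquilinearity rules above and $[a_\lambda[b_\mu c]]=[[a_\lambda b]_{\lambda+\mu}c]+[b_\mu[a_\lambda c]]$),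 $\alpha:Q\to Q\otimes Q$ is a $\mathbf{k}[\partial]$-module homomorphism with $(\mathrm{id}\otimes\alpha)\alpha(a)=(\alpha\otimes\mathrm{id})\alpha(a)+\tau_{12}(\mathrm{id}\otimes\alpha)\alpha(a)$ (Leibniz conformal coalgebra), and, with $L(a)_\lambda b=[a_\lambda b]$, $R(a)_\lambda b=[b_{-\lambda-\partial}a]$, for all $a,b\in Q$: $(R(a)_{\lambda-\partial\otimes\mathrm{id}}\otimes\mathrm{id})\alpha(b)=\tau\big((R(b)_{-\lambda-\partial\otimes\mathrm{id}}\otimes\mathrm{id})\alpha(a)\big)$; $\alpha([a_\lambda b])=(\mathrm{id}\otimes R(b)_{-\lambda-\partial^{\otimes^2}}-L(b)_{-\lambda-\partial^{\otimes^2}}\otimes\mathrm{id}-R(b)_{-\lambda-\partial^{\otimes^2}}\otimes\mathrm{id})(\tau+\mathrm{id})\alpha(a)+(\mathrm{id}\otimes L(a)_\lambda+L(a)_\lambda\otimes\mathrm{id})\alpha(b)$. Substitution convention: in such operators one first computes the polynomial in the subscript variable with coefficients in $Q$ or $Q\otimes Q$, then substitutes the indicated expression, whose $\partial$'s act on the coefficients. *)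

theory Defs
  imports "HOL-Library.Function_Algebras" "HOL-Computational_Algebra.Polynomial"
begin

section \<open>Tensor powers of a vector space\<close>

text \<open>
  The library has no tensor product of abstract vector spaces.  The square \<open>V \<otimes> V\<close> of a vector
  space \<open>V\<close> over \<open>'k\<close> (with scalar multiplication \<open>s\<close>) is modelled as the span of the pure tensors
  \<open>v \<otimes> w\<close>, where \<open>v \<otimes> w\<close> is the form \<open>(\<phi>, \<psi>) \<mapsto> \<phi> v * \<psi> w\<close> on pairs of linear functionals.
  Arguments that are not linear functionals carry no information: every tensor vanishes on them.
  Lemmas \<open>tensor_universal\<close> and \<open>tensor_universal_unique\<close> show that this is the tensor product;
  no finiteness of the dimension is needed.  The cube \<open>V \<otimes> V \<otimes> V\<close> is treated in the same way with three functionals.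
\<close>

type_synonym ('k, 'v) tensor2 = "('v \<Rightarrow> 'k) \<Rightarrow> ('v \<Rightarrow> 'k) \<Rightarrow> 'k"
type_synonym ('k, 'v) tensor3 = "('v \<Rightarrow> 'k) \<Rightarrow> ('v \<Rightarrow> 'k) \<Rightarrow> ('v \<Rightarrow> 'k) \<Rightarrow> 'k"

definition pure2 ::
    "('k::field \<Rightarrow> 'v::ab_group_add \<Rightarrow> 'v) \<Rightarrow> 'v \<Rightarrow> 'v \<Rightarrow> ('k, 'v) tensor2" where
  "pure2 s v w = (\<lambda>\<phi> \<psi>.
     if Vector_Spaces.linear s (*) \<phi> \<and> Vector_Spaces.linear s (*) \<psi> then \<phi> v * \<psi> w else 0)"

definition pure3 ::
    "('k::field \<Rightarrow> 'v::ab_group_add \<Rightarrow> 'v) \<Rightarrow> 'v \<Rightarrow> 'v \<Rightarrow> 'v \<Rightarrow> ('k, 'v) tensor3" where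
  "pure3 s u v w = (\<lambda>\<phi> \<psi> \<chi>.
     if Vector_Spaces.linear s (*) \<phi> \<and> Vector_Spaces.linear s (*) \<psi> \<and> Vector_Spaces.linear s (*) \<chi>
     then \<phi> u * \<psi> v * \<chi> w else 0)"

definition tensor_scale :: "'k::field \<Rightarrow> ('k, 'v) tensor2 \<Rightarrow> ('k, 'v) tensor2" where
  "tensor_scale c T = (\<lambda>\<phi> \<psi>. c * T \<phi> \<psi>)"

definition tensor_space ::
    "('k::field \<Rightarrow> 'v::ab_group_add \<Rightarrow> 'v) \<Rightarrow> ('k, 'v) tensor2 set" where
  "tensor_space s = module.span tensor_scale {pure2 s v w | v w. True}"

text \<open>\<open>tensor_map s' f g\<close> is \<open>f \<otimes> g : V \<otimes> V \<rightarrow> V' \<otimes> V'\<close> for linear \<open>f, g : V \<rightarrow> V'\<close>, where \<open>s'\<close> is the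
  scalar multiplication of the target \<open>V'\<close>.\<close>

definition tensor_map ::
    "('k::field \<Rightarrow> 'w::ab_group_add \<Rightarrow> 'w) \<Rightarrow> ('v \<Rightarrow> 'w) \<Rightarrow> ('v \<Rightarrow> 'w)
      \<Rightarrow> ('k, 'v) tensor2 \<Rightarrow> ('k, 'w) tensor2" where
  "tensor_map s' f g T = (\<lambda>\<phi> \<psi>.
     if Vector_Spaces.linear s' (*) \<phi> \<and> Vector_Spaces.linear s' (*) \<psi> then T (\<phi> \<circ> f) (\<psi> \<circ> g) else 0)"

definition flip :: "('k, 'v) tensor2 \<Rightarrow> ('k, 'v) tensor2" where
  "flip T = (\<lambda>\<phi> \<psi>. T \<psi> \<phi>)"

definition flip12 :: "('k, 'v) tensor3 \<Rightarrow> ('k, 'v) tensor3" where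
  "flip12 T = (\<lambda>\<phi> \<psi> \<chi>. T \<psi> \<phi> \<chi>)"

definition flip23 :: "('k, 'v) tensor3 \<Rightarrow> ('k, 'v) tensor3" where
  "flip23 T = (\<lambda>\<phi> \<psi> \<chi>. T \<phi> \<chi> \<psi>)"

text \<open>\<open>d \<otimes> id\<close> and \<open>id \<otimes> d\<close> from \<open>V \<otimes> V\<close> to \<open>V \<otimes> V \<otimes> V\<close>, for linear \<open>d : V \<rightarrow> V \<otimes> V\<close>.\<close>

definition cop_left :: "('v \<Rightarrow> ('k, 'v) tensor2) \<Rightarrow> ('k, 'v) tensor2 \<Rightarrow> ('k, 'v) tensor3" where
  "cop_left d T = (\<lambda>\<phi> \<psi> \<chi>. T (\<lambda>v. d v \<phi> \<psi>) \<chi>)"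

definition cop_right :: "('v \<Rightarrow> ('k, 'v) tensor2) \<Rightarrow> ('k, 'v) tensor2 \<Rightarrow> ('k, 'v) tensor3" where
  "cop_right d T = (\<lambda>\<phi> \<psi> \<chi>. T \<phi> (\<lambda>v. d v \<psi> \<chi>))"

text \<open>The remaining lemmas of this section confirm that the above are the usual tensor powers and
  tensor operations.\<close>

lemma vector_space_tensor_scale: "vector_space (tensor_scale :: 'k::field \<Rightarrow> ('k, 'v) tensor2 \<Rightarrow> _)"
  by unfold_locales (auto simp: tensor_scale_def fun_eq_iff algebra_simps)

definition tensor_scale3 :: "'k::field \<Rightarrow> ('k, 'v) tensor3 \<Rightarrow> ('k, 'v) tensor3" where
  "tensor_scale3 c T = (\<lambda>\<phi> \<psi> \<chi>. c * T \<phi> \<psi> \<chi>)"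

lemma vector_space_tensor_scale3: "vector_space (tensor_scale3 :: 'k::field \<Rightarrow> ('k, 'v) tensor3 \<Rightarrow> _)"
  by unfold_locales (auto simp: tensor_scale3_def fun_eq_iff algebra_simps)

lemma linear_from_dual_family:
  assumes "vector_space t" "vector_space s'"
    and ev: "\<And>i. i \<in> I \<Longrightarrow> Vector_Spaces.linear t (*) (ev i)"
    and dual: "\<And>i j. i \<in> I \<Longrightarrow> j \<in> I \<Longrightarrow> ev i (e j) = (if i = j then 1 else 0)"
  shows "\<exists>h. Vector_Spaces.linear t s' h \<and> (\<forall>i\<in>I. h (e i) = g i)"
proof -
  interpret T: vector_space t by fact
  interpret P: vector_space_pair t s' by (simp add: vector_space_pair_def assms)
  have inj: "inj_on e I"
    by (rule inj_onI) (metis dual zero_neq_one)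
  have "T.independent (e ` I)"
    unfolding T.independent_explicit_module
  proof (intro allI impI)
    fix S u v
    assume S: "finite S" "S \<subseteq> e ` I" "(\<Sum>v\<in>S. t (u v) v) = 0" "v \<in> S"
    then obtain i where i: "i \<in> I" "v = e i" by auto
    interpret L: Vector_Spaces.linear t "(*)" "ev i" using ev i by blast
    have "0 = ev i (\<Sum>v\<in>S. t (u v) v)" by (simp add: S L.zero)
    also have "\<dots> = (\<Sum>w\<in>S. u w * ev i w)" by (simp add: L.sum L.scale)
    also have "\<dots> = (\<Sum>w\<in>S. if w = v then u v else 0)"
    proof (rule sum.cong)
      fix w assume "w \<in> S"
      then obtain j where "j \<in> I" "w = e j" using S by auto
      then show "u w * ev i w = (if w = v then u v else 0)"
        using dual[OF \<open>i \<in> I\<close> \<open>j \<in> I\<close>] i inj by (auto simp: inj_on_eq_iff)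
    qed simp
    also have "\<dots> = u v" using S by simp
    finally show "u v = 0" by simp
  qed
  then have "Vector_Spaces.linear t s' (P.construct (e ` I) (g \<circ> inv_into I e))"
    and "\<forall>i\<in>I. P.construct (e ` I) (g \<circ> inv_into I e) (e i) = g i"
    using inj by (auto simp: P.linear_construct P.construct_basis)
  then show ?thesis by blast
qed

lemma dual_basis:
  assumes "vector_space (s :: 'k::field \<Rightarrow> 'v::ab_group_add \<Rightarrow> 'v)"
  obtains B f where "module.span s B = UNIV"
    and "\<And>b. b \<in> B \<Longrightarrow> Vector_Spaces.linear s (*) (f b)"
    and "\<And>b c. b \<in> B \<Longrightarrow> c \<in> B \<Longrightarrow> f b c = (if b = c then 1 else 0)"
proof -
  interpret V: vector_space s by fact
  obtain B where B: "V.independent B" "UNIV \<subseteq> V.span B"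
    using V.maximal_independent_subset[of UNIV] by blast
  show thesis
  proof (rule that[of B "\<lambda>b v. V.representation B v b"])
    show "Vector_Spaces.linear s (*) (\<lambda>v. V.representation B v b)" for b
      using B by (intro V.linear_representation) auto
    show "V.representation B c b = (if b = c then 1 else 0)" if "c \<in> B" for b c
      using V.representation_basis[OF B(1) that] by auto
  qed (use B in auto)
qed

lemma linear_pure2:
  assumes "vector_space (s :: 'k::field \<Rightarrow> 'v::ab_group_add \<Rightarrow> 'v)"
  shows "Vector_Spaces.linear s tensor_scale (\<lambda>w. pure2 s v w)"
    and "Vector_Spaces.linear s tensor_scale (\<lambda>v. pure2 s v w)"
  using assms vector_space_tensor_scale
  by (auto simp: Vector_Spaces.linear_iff pure2_def tensor_scale_def fun_eq_iff algebra_simps)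

lemma linear_pure3:
  assumes "vector_space (s :: 'k::field \<Rightarrow> 'v::ab_group_add \<Rightarrow> 'v)"
  shows "Vector_Spaces.linear s tensor_scale3 (\<lambda>w. pure3 s u v w)"
    and "Vector_Spaces.linear s tensor_scale3 (\<lambda>v. pure3 s u v w)"
    and "Vector_Spaces.linear s tensor_scale3 (\<lambda>u. pure3 s u v w)"
  using assms vector_space_tensor_scale3
  by (auto simp: Vector_Spaces.linear_iff pure3_def tensor_scale3_def fun_eq_iff algebra_simps)

lemma linear_eq_on_basis:
  assumes "Vector_Spaces.linear s s' f" "Vector_Spaces.linear s s' g"
    and "module.span s B = UNIV" and "\<And>b. b \<in> B \<Longrightarrow> f b = g b"
  shows "f x = g x"
proof -
  interpret P: vector_space_pair s s'
    using assms(1) by (simp add: vector_space_pair_def Vector_Spaces.linear_iff)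
  show ?thesis using P.linear_eq_on[OF assms(1,2), of x B] assms(3,4) by simp
qed

lemma linear_at_0: "Vector_Spaces.linear s s' f \<Longrightarrow> f 0 = 0"
  by (rule module_hom.zero) (rule Vector_Spaces.linear.axioms)

lemma linear_comp:
  assumes "Vector_Spaces.linear s s' f" "Vector_Spaces.linear s' s'' g"
  shows "Vector_Spaces.linear s s'' (\<lambda>x. g (f x))"
  using assms by (auto simp: Vector_Spaces.linear_iff)

lemma tensor_universal:
  assumes "vector_space (s :: 'k::field \<Rightarrow> 'v::ab_group_add \<Rightarrow> 'v)"
    and "vector_space s'"
    and "\<And>v. Vector_Spaces.linear s s' (\<lambda>w. \<beta> v w)"
    and "\<And>w. Vector_Spaces.linear s s' (\<lambda>v. \<beta> v w)"
  shows "\<exists>h. Vector_Spaces.linear tensor_scale s' h \<and> (\<forall>v w. h (pure2 s v w) = \<beta> v w)"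
proof -
  obtain B f where B: "module.span s B = UNIV"
      "\<And>b. b \<in> B \<Longrightarrow> Vector_Spaces.linear s (*) (f b)"
      "\<And>b c. b \<in> B \<Longrightarrow> c \<in> B \<Longrightarrow> f b c = (if b = c then 1 else 0)"
    using dual_basis[OF assms(1)] by metis
  have "\<exists>h. Vector_Spaces.linear tensor_scale s' h \<and>
      (\<forall>p\<in>B\<times>B. h (pure2 s (fst p) (snd p)) = \<beta> (fst p) (snd p))"
  proof (rule linear_from_dual_family[OF vector_space_tensor_scale assms(2),
        where ev = "\<lambda>p T. T (f (fst p)) (f (snd p))"])
    show "Vector_Spaces.linear tensor_scale (*) (\<lambda>T. T (f (fst p)) (f (snd p)))"
      for p :: "'v \<times> 'v"
      using vector_space_tensor_scale
      by (auto simp: Vector_Spaces.linear_iff tensor_scale_def vector_space_def algebra_simps)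
  qed (auto simp: pure2_def B split: if_splits)
  then obtain h where h: "Vector_Spaces.linear tensor_scale s' h"
      "\<And>b c. b \<in> B \<Longrightarrow> c \<in> B \<Longrightarrow> h (pure2 s b c) = \<beta> b c" by auto
  note lin = linear_comp[OF _ h(1)] linear_pure2[OF assms(1)]
  have "h (pure2 s v c) = \<beta> v c" if "c \<in> B" for v c
    by (rule linear_eq_on_basis[OF lin(1)[OF lin(3)] assms(4) B(1) h(2)]) (use that in auto)
  then have "h (pure2 s v w) = \<beta> v w" for v w
    by (rule linear_eq_on_basis[OF lin(1)[OF lin(2)] assms(3) B(1)])
  then show ?thesis using h by blast
qed

lemma tensor_universal_unique:
  fixes s :: "'k::field \<Rightarrow> 'v::ab_group_add \<Rightarrow> 'v"
  assumes "Vector_Spaces.linear tensor_scale s' h" "Vector_Spaces.linear tensor_scale s' h'"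
    and "\<And>v w. h (pure2 s v w) = h' (pure2 s v w)" and "T \<in> tensor_space s"
  shows "h T = h' T"
proof -
  have "vector_space_pair (tensor_scale :: 'k \<Rightarrow> ('k, 'v) tensor2 \<Rightarrow> _) s'"
    using assms(1) by (simp add: vector_space_pair_def Vector_Spaces.linear_iff)
  from vector_space_pair.linear_eq_on[OF this assms(1,2)] show ?thesis
    using assms(3,4) unfolding tensor_space_def by blast
qed

lemma tensor3_universal:
  assumes "vector_space (s :: 'k::field \<Rightarrow> 'v::ab_group_add \<Rightarrow> 'v)"
    and "vector_space s'"
    and "\<And>u v. Vector_Spaces.linear s s' (\<lambda>w. \<beta> u v w)"
    and "\<And>u w. Vector_Spaces.linear s s' (\<lambda>v. \<beta> u v w)"
    and "\<And>v w. Vector_Spaces.linear s s' (\<lambda>u. \<beta> u v w)"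
  shows "\<exists>h. Vector_Spaces.linear tensor_scale3 s' h \<and> (\<forall>u v w. h (pure3 s u v w) = \<beta> u v w)"
proof -
  obtain B f where B: "module.span s B = UNIV"
      "\<And>b. b \<in> B \<Longrightarrow> Vector_Spaces.linear s (*) (f b)"
      "\<And>b c. b \<in> B \<Longrightarrow> c \<in> B \<Longrightarrow> f b c = (if b = c then 1 else 0)"
    using dual_basis[OF assms(1)] by metis
  have "\<exists>h. Vector_Spaces.linear tensor_scale3 s' h \<and>
      (\<forall>p\<in>B\<times>B\<times>B. h (pure3 s (fst p) (fst (snd p)) (snd (snd p)))
        = \<beta> (fst p) (fst (snd p)) (snd (snd p)))"
  proof (rule linear_from_dual_family[OF vector_space_tensor_scale3 assms(2),
        where ev = "\<lambda>p T. T (f (fst p)) (f (fst (snd p))) (f (snd (snd p)))"])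
    show "Vector_Spaces.linear tensor_scale3 (*)
        (\<lambda>T. T (f (fst p)) (f (fst (snd p))) (f (snd (snd p))))" for p :: "'v \<times> 'v \<times> 'v"
      using vector_space_tensor_scale3
      by (auto simp: Vector_Spaces.linear_iff tensor_scale3_def vector_space_def algebra_simps)
  qed (auto simp: pure3_def B split: if_splits)
  then obtain h where h: "Vector_Spaces.linear tensor_scale3 s' h"
      "\<And>a b c. a \<in> B \<Longrightarrow> b \<in> B \<Longrightarrow> c \<in> B \<Longrightarrow> h (pure3 s a b c) = \<beta> a b c" by auto
  note lin = linear_comp[OF _ h(1)] linear_pure3[OF assms(1)]
  have "h (pure3 s u b c) = \<beta> u b c" if "b \<in> B" "c \<in> B" for u b c
    by (rule linear_eq_on_basis[OF lin(1)[OF lin(4)] assms(5) B(1) h(2)]) (use that in auto)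
  then have "h (pure3 s u v c) = \<beta> u v c" if "c \<in> B" for u v c
    by (rule linear_eq_on_basis[OF lin(1)[OF lin(3)] assms(4) B(1)]) (use that in auto)
  then have "h (pure3 s u v w) = \<beta> u v w" for u v w
    by (rule linear_eq_on_basis[OF lin(1)[OF lin(2)] assms(3) B(1)])
  then show ?thesis using h by blast
qed

lemma tensor_map_pure2:
  assumes "Vector_Spaces.linear s s' f" "Vector_Spaces.linear s s' g"
  shows "tensor_map s' f g (pure2 s v w) = pure2 s' (f v) (g w)"
  using linear_comp[OF assms(1)] linear_comp[OF assms(2)]
  by (auto simp: tensor_map_def pure2_def fun_eq_iff comp_def)

lemma linear_tensor_map: "Vector_Spaces.linear tensor_scale tensor_scale (tensor_map s' f g)"
  by (auto simp: Vector_Spaces.linear_iff vector_space_tensor_scale)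
    (auto simp: tensor_map_def tensor_scale_def fun_eq_iff)

lemma flip_pure:
  "flip (pure2 s v w) = pure2 s w v"
  "flip12 (pure3 s u v w) = pure3 s v u w"
  "flip23 (pure3 s u v w) = pure3 s u w v"
  by (auto simp: flip_def flip12_def flip23_def pure2_def pure3_def fun_eq_iff)

lemma tensor2_cases:
  assumes "vector_space s" and "T \<in> tensor_space s"
  obtains n :: nat and x y where "T = (\<Sum>i<n. pure2 s (x i) (y i))"
proof -
  interpret T: vector_space tensor_scale by (rule vector_space_tensor_scale)
  have "\<exists>(n::nat) x y. T = (\<Sum>i<n. pure2 s (x i) (y i))"
    using assms(2) unfolding tensor_space_def
  proof (induction rule: T.span_induct_alt)
    case base
    then show ?case by (intro exI[of _ 0]) simp
  next
    case (step c X T)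
    then obtain v w n x y where "X = pure2 s v w" "T = (\<Sum>i<n::nat. pure2 s (x i) (y i))" by auto
    then have "tensor_scale c X + T
        = (\<Sum>i<Suc n. pure2 s ((x(n := s c v)) i) ((y(n := w)) i))"
      using linear_pure2(2)[OF assms(1)] by (simp add: Vector_Spaces.linear_iff)
    then show ?case by blast
  qed
  then show thesis using that by blast
qed

lemma sum_fun_apply: "(\<Sum>i\<in>I. f i) x = (\<Sum>i\<in>I. f i x)"
  by (induction I rule: infinite_finite_induct) auto

lemma cop_pure2:
  assumes "Vector_Spaces.linear s tensor_scale d"
  shows "d v = (\<Sum>i\<in>I. pure2 s (x i) (y i)) \<Longrightarrow>
      cop_left d (pure2 s v w) = (\<Sum>i\<in>I. pure3 s (x i) (y i) w)"
    and "d w = (\<Sum>i\<in>I. pure2 s (x i) (y i)) \<Longrightarrow>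
      cop_right d (pure2 s v w) = (\<Sum>i\<in>I. pure3 s v (x i) (y i))"
proof -
  have "Vector_Spaces.linear s (*) (\<lambda>v. d v \<phi> \<psi>)" for \<phi> \<psi>
    using assms by (auto simp: Vector_Spaces.linear_iff tensor_scale_def vector_space_def algebra_simps)
  then show "d v = (\<Sum>i\<in>I. pure2 s (x i) (y i)) \<Longrightarrow>
      cop_left d (pure2 s v w) = (\<Sum>i\<in>I. pure3 s (x i) (y i) w)"
    and "d w = (\<Sum>i\<in>I. pure2 s (x i) (y i)) \<Longrightarrow>
      cop_right d (pure2 s v w) = (\<Sum>i\<in>I. pure3 s v (x i) (y i))"
    by (auto simp: cop_left_def cop_right_def fun_eq_iff pure2_def pure3_def sum_fun_apply
        sum_distrib_left sum_distrib_right mult.assoc intro!: sum.cong)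
qed


section \<open>Polynomials with coefficients in a vector space\<close>

text \<open>
  \<open>Q[\<lambda>]\<close> is \<^typ>\<open>'q poly\<close>; only the additive structure of the coefficients is used.  Multiplication
  by the indeterminate is \<open>pCons 0\<close>, and an additive map on coefficients is extended by \<open>map_poly\<close>.
\<close>

definition poly_scale :: "('k \<Rightarrow> 'q::zero \<Rightarrow> 'q) \<Rightarrow> 'k \<Rightarrow> 'q poly \<Rightarrow> 'q poly" where
  "poly_scale s c = map_poly (s c)"

text \<open>\<open>poly_subst e X p\<close> substitutes the operator \<open>X\<close> for the indeterminate of \<open>p\<close>, after embedding
  the coefficients by \<open>e\<close>; thus for \<open>X = - \<lambda> - \<partial>\<close> the \<open>\<partial>\<close> acts on the coefficients of \<open>p\<close>.\<close>

definition poly_subst :: "('q::zero \<Rightarrow> 'm::comm_monoid_add) \<Rightarrow> ('m \<Rightarrow> 'm) \<Rightarrow> 'q poly \<Rightarrow> 'm" where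
  "poly_subst e X p = (\<Sum>i\<le>degree p. (X ^^ i) (e (coeff p i)))"

abbreviation (input) const_poly :: "'q::zero \<Rightarrow> 'q poly" where
  "const_poly q \<equiv> [:q:]"

text \<open>\<open>F \<otimes> id\<close> and \<open>id \<otimes> F\<close> from \<open>Q \<otimes> Q\<close> to \<open>(Q \<otimes> Q)[\<lambda>]\<close>, for linear \<open>F : Q \<rightarrow> Q[\<lambda>]\<close>.\<close>

definition poly_tensor_left ::
    "('k::field \<Rightarrow> 'q::ab_group_add \<Rightarrow> 'q) \<Rightarrow> ('q \<Rightarrow> 'q poly) \<Rightarrow> ('k, 'q) tensor2
      \<Rightarrow> ('k, 'q) tensor2 poly" where
  "poly_tensor_left s F T = Abs_poly (\<lambda>n. tensor_map s (\<lambda>v. coeff (F v) n) id T)"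

definition poly_tensor_right ::
    "('k::field \<Rightarrow> 'q::ab_group_add \<Rightarrow> 'q) \<Rightarrow> ('q \<Rightarrow> 'q poly) \<Rightarrow> ('k, 'q) tensor2
      \<Rightarrow> ('k, 'q) tensor2 poly" where
  "poly_tensor_right s F T = Abs_poly (\<lambda>n. tensor_map s id (\<lambda>v. coeff (F v) n) T)"

lemma coeff_poly_tensor:
  assumes "vector_space s" and F: "Vector_Spaces.linear s (poly_scale s) F"
    and "T \<in> tensor_space s"
  shows "coeff (poly_tensor_left s F T) n = tensor_map s (\<lambda>v. coeff (F v) n) id T"
    and "coeff (poly_tensor_right s F T) n = tensor_map s id (\<lambda>v. coeff (F v) n) T"
proof -
  interpret V: vector_space s by fact
  have lin: "Vector_Spaces.linear s s (\<lambda>v. coeff (F v) n)" for n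
    using F by (auto simp: Vector_Spaces.linear_iff poly_scale_def coeff_map_poly)
  have id: "Vector_Spaces.linear s s id" by (rule V.linear_id)
  interpret L: Vector_Spaces.linear tensor_scale tensor_scale "tensor_map s f g"
    for f g :: "'b \<Rightarrow> 'b" by (rule linear_tensor_map)
  obtain m :: nat and x y where T: "T = (\<Sum>i<m. pure2 s (x i) (y i))"
    using tensor2_cases[OF assms(1,3)] by metis
  define N where "N = (\<Sum>i<m. degree (F (x i)) + degree (F (y i)))"
  have le: "degree (F (x i)) \<le> N" "degree (F (y i)) \<le> N" if "i < m" for i
    using member_le_sum[of i "{..<m}" "\<lambda>i. degree (F (x i)) + degree (F (y i))"] that
    by (auto simp: N_def)
  have zero: "pure2 s 0 v = 0" "pure2 s v 0 = 0" for v
    using linear_at_0[OF linear_pure2(1)[OF assms(1)]] linear_at_0[OF linear_pure2(2)[OF assms(1)]] by auto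
  have c0: "coeff (F (x i)) n = 0" "coeff (F (y i)) n = 0" if "i < m" "n > N" for i n
    using le[OF that(1)] that(2) by (auto intro!: coeff_eq_0)
  have "tensor_map s (\<lambda>v. coeff (F v) n) id T = 0" "tensor_map s id (\<lambda>v. coeff (F v) n) T = 0"
    if "n > N" for n
    using c0[OF _ that] by (simp_all add: T L.sum tensor_map_pure2[OF lin id] tensor_map_pure2[OF id lin] zero)
  then have "coeff (Abs_poly (\<lambda>n. tensor_map s (\<lambda>v. coeff (F v) n) id T))
      = (\<lambda>n. tensor_map s (\<lambda>v. coeff (F v) n) id T)"
    "coeff (Abs_poly (\<lambda>n. tensor_map s id (\<lambda>v. coeff (F v) n) T))
      = (\<lambda>n. tensor_map s id (\<lambda>v. coeff (F v) n) T)"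
    by (auto intro!: coeff_Abs_poly[where n = N])
  then show "coeff (poly_tensor_left s F T) n = tensor_map s (\<lambda>v. coeff (F v) n) id T"
    and "coeff (poly_tensor_right s F T) n = tensor_map s id (\<lambda>v. coeff (F v) n) T"
    by (simp_all add: poly_tensor_left_def poly_tensor_right_def)
qed


section \<open>Novikov dialgebras, co-dialgebras and bi-dialgebras\<close>

locale novikov_dialgebra = vector_space s
  for s :: "'k::field \<Rightarrow> 'a::ab_group_add \<Rightarrow> 'a" +
  fixes ld :: "'a \<Rightarrow> 'a \<Rightarrow> 'a" (infixl \<open>\<stileturn>\<close> 70)
    and rd :: "'a \<Rightarrow> 'a \<Rightarrow> 'a" (infixl \<open>\<turnstile>\<close> 70)
  assumes ld_linear_right: "Vector_Spaces.linear s s (\<lambda>b. a \<stileturn> b)"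
    and ld_linear_left: "Vector_Spaces.linear s s (\<lambda>a. a \<stileturn> b)"
    and rd_linear_right: "Vector_Spaces.linear s s (\<lambda>b. a \<turnstile> b)"
    and rd_linear_left: "Vector_Spaces.linear s s (\<lambda>a. a \<turnstile> b)"
    and nov1: "(a \<turnstile> b) \<stileturn> c = (a \<turnstile> c) \<turnstile> b"
    and nov2: "(a \<turnstile> c) \<turnstile> b = (a \<stileturn> c) \<turnstile> b"
    and nov3: "a \<stileturn> (b \<stileturn> c) = a \<stileturn> (b \<turnstile> c)"
    and nov4: "(a \<stileturn> b) \<stileturn> c = (a \<stileturn> c) \<stileturn> b"
    and nov5: "(a \<stileturn> b) \<stileturn> c - a \<stileturn> (b \<stileturn> c) = (b \<turnstile> a) \<stileturn> c - b \<turnstile> (a \<stileturn> c)"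
    and nov6: "(a \<turnstile> b) \<turnstile> c - a \<turnstile> (b \<turnstile> c) = (b \<turnstile> a) \<turnstile> c - b \<turnstile> (a \<turnstile> c)"

locale novikov_codialgebra = vector_space s
  for s :: "'k::field \<Rightarrow> 'a::ab_group_add \<Rightarrow> 'a" +
  fixes \<delta> \<Delta> :: "'a \<Rightarrow> ('k, 'a) tensor2"
  assumes \<delta>_linear: "Vector_Spaces.linear s tensor_scale \<delta>"
    and \<delta>_tensor: "\<delta> a \<in> tensor_space s"
    and \<Delta>_linear: "Vector_Spaces.linear s tensor_scale \<Delta>"
    and \<Delta>_tensor: "\<Delta> a \<in> tensor_space s"
    and conov1: "cop_left \<delta> (\<delta> a) = flip23 (cop_left \<delta> (\<delta> a))"
    and conov2: "cop_left \<Delta> (\<delta> a) = flip23 (cop_left \<Delta> (\<Delta> a))"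
    and conov3: "flip23 (cop_left \<Delta> (\<Delta> a)) = flip23 (cop_left \<delta> (\<Delta> a))"
    and conov4: "cop_right \<delta> (\<delta> a) = cop_right \<Delta> (\<delta> a)"
    and conov5: "cop_left \<delta> (\<delta> a) - cop_right \<delta> (\<delta> a)
                  = flip12 (cop_left \<Delta> (\<delta> a) - cop_right \<delta> (\<Delta> a))"
    and conov6: "cop_left \<Delta> (\<Delta> a) - cop_right \<Delta> (\<Delta> a)
                  = flip12 (cop_left \<Delta> (\<Delta> a) - cop_right \<Delta> (\<Delta> a))"

text \<open>\<open>oL m a\<close> and \<open>oR m a\<close> are left and right multiplication by \<open>a\<close> for the product \<open>m\<close>; operators
  are added pointwise.\<close>

definition oL :: "('a \<Rightarrow> 'a \<Rightarrow> 'a) \<Rightarrow> 'a \<Rightarrow> 'a \<Rightarrow> 'a" where "oL m a = (\<lambda>b. m a b)"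
definition oR :: "('a \<Rightarrow> 'a \<Rightarrow> 'a) \<Rightarrow> 'a \<Rightarrow> 'a \<Rightarrow> 'a" where "oR m a = (\<lambda>b. m b a)"

definition star :: "('a::ab_group_add \<Rightarrow> 'a \<Rightarrow> 'a) \<Rightarrow> ('a \<Rightarrow> 'a \<Rightarrow> 'a) \<Rightarrow> 'a \<Rightarrow> 'a \<Rightarrow> 'a" where
  "star ld rd a b = - ld a b - rd b a + rd a b + ld b a"

locale novikov_bidialgebra =
  novikov_dialgebra s ld rd + novikov_codialgebra s \<delta> \<Delta>
  for s :: "'k::field \<Rightarrow> 'a::ab_group_add \<Rightarrow> 'a"
    and ld :: "'a \<Rightarrow> 'a \<Rightarrow> 'a" (infixl \<open>\<stileturn>\<close> 70)
    and rd :: "'a \<Rightarrow> 'a \<Rightarrow> 'a" (infixl \<open>\<turnstile>\<close> 70)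
    and \<delta> \<Delta> :: "'a \<Rightarrow> ('k, 'a) tensor2" +
  assumes binov1: "tensor_map s (oL ld a) id (\<Delta> b)
      = - tensor_map s id (oL ld b + oR rd b) (\<delta> a)"
    and binov2: "tensor_map s id (oL ld b) (\<delta> a) = tensor_map s (oL ld a) id (flip (\<delta> b))"
    and binov3: "tensor_map s id (oL ld a + oR rd a) (\<delta> b + flip (\<Delta> b))
      = tensor_map s (oR rd b) id (\<Delta> a)"
    and binov4: "\<delta> (a \<stileturn> b) = tensor_map s (oR ld b) id (\<delta> a)
      + tensor_map s id (oL (star ld rd) a) ((\<delta> b - \<Delta> b) - flip (\<delta> b - \<Delta> b))"
    and binov5: "\<delta> (a \<turnstile> b) = tensor_map s (oR rd b) id (\<delta> a - \<Delta> a)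
      + tensor_map s id (oL rd a + oR ld a) (\<delta> b + flip (\<Delta> b))"
    and binov6: "\<Delta> (a \<stileturn> b)
      = tensor_map s id (oL ld a + oR rd a) ((\<Delta> b - \<delta> b) - flip (\<Delta> b - \<delta> b))
      + tensor_map s (oR ld b) id (\<Delta> a)"
    and binov7: "\<Delta> (a \<turnstile> b) = tensor_map s (oR rd b - oR ld b) id (\<delta> a - \<Delta> a)
      + tensor_map s id (oL rd a + oR ld a) (flip (\<delta> b) + \<Delta> b)"
    and binov8: "tensor_map s (oL ld b + oR rd b) id (\<delta> a - \<Delta> a)
      + tensor_map s id (oL (star ld rd) b) (flip (\<delta> a - \<Delta> a))
      - tensor_map s (oL rd a + oR ld a) id (\<delta> b)
      + tensor_map s id (oL rd a + oR ld a) (flip (\<Delta> b)) = 0"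
    and binov9: "tensor_map s id (oR rd a) ((\<delta> b - \<Delta> b) - flip (\<delta> b - \<Delta> b))
      - tensor_map s (oR ld b) id (\<Delta> a + flip (\<delta> a))
      = - tensor_map s id (oR ld b) (\<Delta> a + flip (\<delta> a))
      + tensor_map s (oR rd a - oR ld a) id ((\<Delta> b - \<delta> b) - flip (\<Delta> b - \<delta> b))"


section \<open>Leibniz conformal algebras, coalgebras and bialgebras\<close>

text \<open>A \<open>k[\<partial>]\<close>-module is given by a vector space together with the linear endomorphism \<open>D = \<partial>\<close>.
  In the Jacobi identity, \<open>Q[\<lambda>, \<mu>]\<close> is \<^typ>\<open>'q poly poly\<close> with outer indeterminate \<open>\<lambda>\<close> and inner
  indeterminate \<open>\<mu>\<close>.\<close>

definition mult_lambda :: "'q::zero poly poly \<Rightarrow> 'q poly poly" where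
  "mult_lambda = pCons 0"

definition mult_mu :: "'q::zero poly poly \<Rightarrow> 'q poly poly" where
  "mult_mu = map_poly (pCons 0)"

definition bracket_at ::
    "('q::ab_group_add \<Rightarrow> 'q \<Rightarrow> 'q poly) \<Rightarrow> ('q poly poly \<Rightarrow> 'q poly poly) \<Rightarrow> 'q \<Rightarrow> 'q
      \<Rightarrow> 'q poly poly" where
  "bracket_at br X a b = poly_subst (\<lambda>q. [:[:q:]:]) X (br a b)"

locale leibniz_conformal_algebra = vector_space s
  for s :: "'k::field \<Rightarrow> 'q::ab_group_add \<Rightarrow> 'q" +
  fixes D :: "'q \<Rightarrow> 'q"
    and br :: "'q \<Rightarrow> 'q \<Rightarrow> 'q poly"
  assumes D_linear: "Vector_Spaces.linear s s D"
    and br_linear_right: "Vector_Spaces.linear s (poly_scale s) (\<lambda>b. br a b)"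
    and br_linear_left: "Vector_Spaces.linear s (poly_scale s) (\<lambda>a. br a b)"
    and br_D_left: "br (D a) b = - pCons 0 (br a b)"
    and br_D_right: "br a (D b) = pCons 0 (br a b) + map_poly D (br a b)"
    and jacobi: "poly_subst (bracket_at br mult_lambda a) mult_mu (br b c)
      = poly_subst (\<lambda>q. bracket_at br (mult_lambda + mult_mu) q c) mult_lambda (br a b)
      + poly_subst (bracket_at br mult_mu b) mult_lambda (br a c)"

definition tensor_D ::
    "('k::field \<Rightarrow> 'q::ab_group_add \<Rightarrow> 'q) \<Rightarrow> ('q \<Rightarrow> 'q) \<Rightarrow> ('k, 'q) tensor2 \<Rightarrow> ('k, 'q) tensor2" where
  "tensor_D s D T = tensor_map s D id T + tensor_map s id D T"

definition D_hom_to_square ::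
    "('k::field \<Rightarrow> 'q::ab_group_add \<Rightarrow> 'q) \<Rightarrow> ('q \<Rightarrow> 'q) \<Rightarrow> ('q \<Rightarrow> ('k, 'q) tensor2) \<Rightarrow> bool" where
  "D_hom_to_square s D f \<longleftrightarrow>
     Vector_Spaces.linear s tensor_scale f \<and> (\<forall>q. f q \<in> tensor_space s) \<and>
     (\<forall>q. f (D q) = tensor_D s D (f q))"

locale leibniz_conformal_coalgebra = vector_space s
  for s :: "'k::field \<Rightarrow> 'q::ab_group_add \<Rightarrow> 'q" +
  fixes D :: "'q \<Rightarrow> 'q"
    and \<alpha> :: "'q \<Rightarrow> ('k, 'q) tensor2"
  assumes co_D_linear: "Vector_Spaces.linear s s D"
    and \<alpha>_hom: "D_hom_to_square s D \<alpha>"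
    and cojacobi: "cop_right \<alpha> (\<alpha> a) = cop_left \<alpha> (\<alpha> a) + flip12 (cop_right \<alpha> (\<alpha> a))"

text \<open>\<open>cL br a b\<close> is \<open>L(a)\<^sub>\<lambda> b = [a \<^sub>\<lambda> b]\<close> and \<open>cR D br a b\<close> is \<open>R(a)\<^sub>\<lambda> b = [b \<^sub>-\<^sub>\<lambda>\<^sub>-\<^sub>\<partial> a]\<close>.\<close>

definition cL :: "('q \<Rightarrow> 'q \<Rightarrow> 'q poly) \<Rightarrow> 'q \<Rightarrow> 'q \<Rightarrow> 'q::ab_group_add poly" where
  "cL br a b = br a b"

definition cR :: "('q \<Rightarrow> 'q) \<Rightarrow> ('q \<Rightarrow> 'q \<Rightarrow> 'q poly) \<Rightarrow> 'q \<Rightarrow> 'q \<Rightarrow> 'q::ab_group_add poly" where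
  "cR D br a b = poly_subst const_poly (\<lambda>p. - pCons 0 p - map_poly D p) (br b a)"

text \<open>The three substitutions into polynomials with coefficients in \<open>Q \<otimes> Q\<close>:
  \<open>\<lambda> - \<partial> \<otimes> id\<close>, \<open>- \<lambda> - \<partial> \<otimes> id\<close> and \<open>- \<lambda> - \<partial>\<^sup>\<otimes>\<^sup>2\<close>.\<close>

definition subst_minus_D1 ::
    "('k::field \<Rightarrow> 'q::ab_group_add \<Rightarrow> 'q) \<Rightarrow> ('q \<Rightarrow> 'q) \<Rightarrow> ('k, 'q) tensor2 poly
      \<Rightarrow> ('k, 'q) tensor2 poly" where
  "subst_minus_D1 s D =
     poly_subst const_poly (\<lambda>P. pCons 0 P - map_poly (tensor_map s D id) P)"

definition subst_neg_D1 ::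
    "('k::field \<Rightarrow> 'q::ab_group_add \<Rightarrow> 'q) \<Rightarrow> ('q \<Rightarrow> 'q) \<Rightarrow> ('k, 'q) tensor2 poly
      \<Rightarrow> ('k, 'q) tensor2 poly" where
  "subst_neg_D1 s D =
     poly_subst const_poly (\<lambda>P. - pCons 0 P - map_poly (tensor_map s D id) P)"

definition subst_neg_D2 ::
    "('k::field \<Rightarrow> 'q::ab_group_add \<Rightarrow> 'q) \<Rightarrow> ('q \<Rightarrow> 'q) \<Rightarrow> ('k, 'q) tensor2 poly
      \<Rightarrow> ('k, 'q) tensor2 poly" where
  "subst_neg_D2 s D =
     poly_subst const_poly (\<lambda>P. - pCons 0 P - map_poly (tensor_D s D) P)"

locale leibniz_conformal_bialgebra =
  leibniz_conformal_algebra s D br + leibniz_conformal_coalgebra s D \<alpha>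
  for s :: "'k::field \<Rightarrow> 'q::ab_group_add \<Rightarrow> 'q"
    and D :: "'q \<Rightarrow> 'q"
    and br :: "'q \<Rightarrow> 'q \<Rightarrow> 'q poly"
    and \<alpha> :: "'q \<Rightarrow> ('k, 'q) tensor2" +
  assumes compat1:
      "subst_minus_D1 s D (poly_tensor_left s (cR D br a) (\<alpha> b))
       = map_poly flip (subst_neg_D1 s D (poly_tensor_left s (cR D br b) (\<alpha> a)))"
    and compat2:
      "map_poly \<alpha> (br a b)
       = subst_neg_D2 s D (poly_tensor_right s (cR D br b) (flip (\<alpha> a) + \<alpha> a))
       - subst_neg_D2 s D (poly_tensor_left s (cL br b) (flip (\<alpha> a) + \<alpha> a))
       - subst_neg_D2 s D (poly_tensor_left s (cR D br b) (flip (\<alpha> a) + \<alpha> a))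
       + poly_tensor_right s (cL br a) (\<alpha> b)
       + poly_tensor_left s (cL br a) (\<alpha> b)"


section \<open>The conformal algebra of a Novikov dialgebra\<close>

text \<open>\<open>k[\<partial>] \<otimes> A\<close> is \<^typ>\<open>'a poly\<close> (with indeterminate \<open>\<partial>\<close>), on which \<open>\<partial>\<close> acts as \<open>pCons 0\<close>, and
  \<open>a\<close> in \<open>A\<close> is identified with \<open>[:a:]\<close>.  The bracket takes values in \<^typ>\<open>'a poly poly\<close>, with outer
  indeterminate \<open>\<lambda>\<close> and inner indeterminate \<open>\<partial>\<close>.\<close>

definition base_bracket ::
    "('a::ab_group_add \<Rightarrow> 'a \<Rightarrow> 'a) \<Rightarrow> ('a \<Rightarrow> 'a \<Rightarrow> 'a) \<Rightarrow> 'a \<Rightarrow> 'a \<Rightarrow> 'a poly poly" where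
  "base_bracket ld rd a b = [: [: 0, ld b a :], [: rd a b + ld b a :] :]"

text \<open>The sesquilinear extension: \<open>[\<partial>\<^sup>i a \<^sub>\<lambda> \<partial>\<^sup>j b] = (-\<lambda>)\<^sup>i (\<lambda> + \<partial>)\<^sup>j [a \<^sub>\<lambda> b]\<close> for \<open>a, b\<close> in \<open>A\<close>.\<close>

definition dialgebra_bracket ::
    "('a::ab_group_add \<Rightarrow> 'a \<Rightarrow> 'a) \<Rightarrow> ('a \<Rightarrow> 'a \<Rightarrow> 'a) \<Rightarrow> 'a poly \<Rightarrow> 'a poly \<Rightarrow> 'a poly poly" where
  "dialgebra_bracket ld rd p q = (\<Sum>i\<le>degree p. \<Sum>j\<le>degree q.
     ((\<lambda>r. - pCons 0 r) ^^ i) (((\<lambda>r. pCons 0 r + map_poly (pCons 0) r) ^^ j)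
       (base_bracket ld rd (coeff p i) (coeff q j))))"

lemma (in novikov_dialgebra) dialgebra_bracket_const:
  "dialgebra_bracket ld rd [:a:] [:b:] = [: [: 0, b \<stileturn> a :], [: a \<turnstile> b + b \<stileturn> a :] :]"
  by (simp add: dialgebra_bracket_def base_bracket_def)

lemma funpow_additive:
  fixes f :: "'m::ab_group_add \<Rightarrow> 'm"
  assumes "\<And>x y. f (x + y) = f x + f y" "f 0 = 0"
  shows "(f ^^ n) (x + y) = (f ^^ n) x + (f ^^ n) y" "(f ^^ n) 0 = 0"
    "(f ^^ n) (sum g I) = (\<Sum>i\<in>I. (f ^^ n) (g i))"
proof -
  show 1: "(f ^^ n) (x + y) = (f ^^ n) x + (f ^^ n) y" for x y
    by (induction n) (auto simp: assms)
  show 2: "(f ^^ n) 0 = 0" by (induction n) (auto simp: assms)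
  show "(f ^^ n) (sum g I) = (\<Sum>i\<in>I. (f ^^ n) (g i))"
    by (induction I rule: infinite_finite_induct) (auto simp: 1 2)
qed

lemma (in novikov_dialgebra) dialgebra_bracket_sesquilinear:
  "dialgebra_bracket ld rd (pCons 0 p) q = - pCons 0 (dialgebra_bracket ld rd p q)"
  "dialgebra_bracket ld rd p (pCons 0 q)
     = pCons 0 (dialgebra_bracket ld rd p q) + map_poly (pCons 0) (dialgebra_bracket ld rd p q)"
proof -
  let ?X = "\<lambda>r::'a poly poly. - pCons 0 r"
  let ?Y = "\<lambda>r::'a poly poly. pCons 0 r + map_poly (pCons 0) r"
  have m: "map_poly (pCons 0) (x + y) = map_poly (pCons 0) x + map_poly (pCons 0) y"
    for x y :: "'a poly poly"
    by (rule poly_eqI) (simp add: coeff_map_poly)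
  have X: "?X (x + y) = ?X x + ?X y" "?X 0 = 0" for x y
    by simp_all
  have Y: "?Y (x + y) = ?Y x + ?Y y" "?Y 0 = 0" for x y
    by (simp_all add: m)
  have XY: "?Y (?X x) = ?X (?Y x)" for x
    by (rule poly_eqI) (auto simp: coeff_map_poly coeff_pCons split: nat.splits)
  have XnY: "?Y ((?X ^^ n) x) = (?X ^^ n) (?Y x)" for n x
    by (induction n arbitrary: x) (simp_all add: XY del: minus_pCons)
  have 0: "base_bracket ld rd 0 b = 0" "base_bracket ld rd b 0 = 0" for b
    by (simp_all add: base_bracket_def linear_at_0[OF ld_linear_right] linear_at_0[OF rd_linear_right]
        linear_at_0[OF ld_linear_left] linear_at_0[OF rd_linear_left])
  define t where "t i j = (?X ^^ i) ((?Y ^^ j) (base_bracket ld rd (coeff p i) (coeff q j)))" for i j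
  have e: "dialgebra_bracket ld rd p q = (\<Sum>i\<le>degree p. \<Sum>j\<le>degree q. t i j)"
    by (simp add: dialgebra_bracket_def t_def)
  have Xs: "?X (sum g I) = (\<Sum>i\<in>I. ?X (g i))" for g and I :: "nat set"
    using funpow_additive(3)[of ?X 1 g I] by simp
  have Ys: "?Y (sum g I) = (\<Sum>i\<in>I. ?Y (g i))" for g and I :: "nat set"
    using funpow_additive(3)[OF Y, of 1 g I] by simp
  show "dialgebra_bracket ld rd (pCons 0 p) q = ?X (dialgebra_bracket ld rd p q)"
  proof (cases "p = 0")
    case True
    then show ?thesis by (simp add: dialgebra_bracket_def 0 funpow_additive(2)[OF Y])
  next
    case False
    then have "dialgebra_bracket ld rd (pCons 0 p) q = (\<Sum>i\<le>degree p. \<Sum>j\<le>degree q. ?X (t i j))"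
      by (simp add: dialgebra_bracket_def sum.atMost_Suc_shift t_def 0 funpow_additive(2)[OF Y]
          del: sum.atMost_Suc)
    then show ?thesis by (simp only: e Xs)
  qed
  show "dialgebra_bracket ld rd p (pCons 0 q) = ?Y (dialgebra_bracket ld rd p q)"
  proof (cases "q = 0")
    case True
    then show ?thesis
      by (simp add: dialgebra_bracket_def 0 funpow_additive(2)[OF X] del: minus_pCons)
  next
    case False
    then have "dialgebra_bracket ld rd p (pCons 0 q)
        = (\<Sum>i\<le>degree p. \<Sum>j\<le>degree q. (?X ^^ i) (?Y ((?Y ^^ j) (base_bracket ld rd (coeff p i) (coeff q j)))))"
      by (simp add: dialgebra_bracket_def sum.atMost_Suc_shift 0 funpow_additive(2)[OF X]
          del: sum.atMost_Suc minus_pCons)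
    also have "\<dots> = (\<Sum>i\<le>degree p. \<Sum>j\<le>degree q. ?Y (t i j))"
      by (simp only: t_def XnY)
    finally show ?thesis by (simp only: e Ys)
  qed
qed

text \<open>The inclusion of \<open>A \<otimes> A\<close> into the square of \<open>k[\<partial>] \<otimes> A\<close>, and the restriction to \<open>A\<close> of a map
  \<open>f\<close> into that square which sends \<open>A\<close> into \<open>A \<otimes> A\<close>.\<close>

definition square_incl ::
    "('k::field \<Rightarrow> 'a::ab_group_add \<Rightarrow> 'a) \<Rightarrow> ('k, 'a) tensor2 \<Rightarrow> ('k, 'a poly) tensor2" where
  "square_incl s = tensor_map (poly_scale s) const_poly const_poly"

definition restrict_to_A ::
    "('k::field \<Rightarrow> 'a::ab_group_add \<Rightarrow> 'a) \<Rightarrow> ('a poly \<Rightarrow> ('k, 'a poly) tensor2)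
      \<Rightarrow> 'a \<Rightarrow> ('k, 'a) tensor2" where
  "restrict_to_A s f a = inv_into (tensor_space s) (square_incl s) (f [:a:])"

lemma inj_on_square_incl:
  assumes "vector_space s"
  shows "inj_on (square_incl s) (tensor_space s)"
proof (rule inj_on_inverseI[where g = "tensor_map s (\<lambda>p. coeff p 0) (\<lambda>p. coeff p 0)"])
  fix T assume T: "T \<in> tensor_space s"
  interpret V: vector_space s by fact
  have ps: "vector_space (poly_scale s)"
    by unfold_locales
      (auto simp: poly_scale_def poly_eq_iff coeff_map_poly V.scale_right_distrib V.scale_left_distrib)
  have l: "Vector_Spaces.linear s (poly_scale s) const_poly"
    "Vector_Spaces.linear (poly_scale s) s (\<lambda>p. coeff p 0)"
    using ps assms by (auto simp: Vector_Spaces.linear_iff poly_scale_def coeff_map_poly map_poly_pCons)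
  let ?h = "\<lambda>T. tensor_map s (\<lambda>p. coeff p 0) (\<lambda>p. coeff p 0) (square_incl s T)"
  have "Vector_Spaces.linear tensor_scale tensor_scale ?h"
    unfolding square_incl_def by (rule linear_comp[OF linear_tensor_map linear_tensor_map])
  moreover have "?h (pure2 s v w) = pure2 s v w" for v w
    by (simp add: square_incl_def tensor_map_pure2[OF l(1) l(1)] tensor_map_pure2[OF l(2) l(2)])
  ultimately show "?h T = T"
    using tensor_universal_unique[OF _ vector_space.linear_ident[OF vector_space_tensor_scale] _ T]
    by blast
qed

end

theory Submission
  imports Defs
begin

text \<open>
  All the identities in question live in spaces of polynomials in \<open>\<partial>\<close>'s and \<open>\<lambda>\<close> with vector
  coefficients.  The field is infinite, so such an identity may be tested by giving the
  indeterminates scalar values and applying linear functionals of \<open>A\<close> to the coefficients.  Write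
  \<open>p(x)\<close> for the value of \<open>p\<close> in \<open>k[\<partial>] \<otimes> A\<close> at \<open>\<partial> = x\<close>, and \<open>f\<^sub>x\<close> for the functional \<open>p \<mapsto> f(p(x))\<close>,
  where \<open>f\<close> is a functional on \<open>A\<close>.  The functionals \<open>f\<^sub>x\<close> are eigenvectors of the transpose of \<open>\<partial>\<close>
  with eigenvalue \<open>x\<close>; therefore each substitution such as \<open>- \<lambda> - \<partial> \<otimes> id\<close>, with \<open>\<partial>\<close> acting on
  coefficients, turns into the substitution of a scalar.  Three formulas then describe the whole
  structure, \<open>\<delta>\<close> and \<open>\<Delta>\<close> on the right being the restrictions to \<open>A\<close>:

    \<^item> \<open>[p \<^sub>l q](x) = x (b \<stileturn> a) + l (a \<turnstile> b + b \<stileturn> a)\<close> with \<open>a = p(-l)\<close> and \<open>b = q(l + x)\<close>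
      (lemma \<open>ev_bracket\<close>);
    \<^item> \<open>\<alpha>(p)(f\<^sub>x, g\<^sub>y) = x \<Delta>(a)(f, g) - y \<delta>(a)(g, f)\<close> with \<open>a = p(x + y)\<close> (lemma \<open>\<alpha>_at\<close>);
    \<^item> \<open>(R(p)\<^sub>l q)(x) = [q \<^sub>\<nu> p](x)\<close> with the scalar \<open>\<nu> = - l - x\<close> (lemma \<open>ev_cR\<close>).

  Consequently each axiom that a Leibniz conformal bialgebra imposes on \<open>\<alpha>\<close>, beyond \<open>\<partial>\<close>-linearity, becomes a family of scalar identities
  whose difference of sides is a quadratic form in the scalar values of the indeterminates.  Its
  coefficients are signed sums of the differences between the two sides of the axioms of a Novikov
  bi-dialgebra, evaluated at functionals of \<open>A\<close>: the coalgebra axiom gives the co-dialgebra axioms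
  (lemma \<open>cojacobi_at\<close>), \<open>compat1\<close> gives \<open>binov1\<close> to \<open>binov3\<close> (\<open>compat1_at\<close>), and \<open>compat2\<close> gives
  \<open>binov4\<close> to \<open>binov9\<close> (\<open>compat2_at\<close>).  These three lemmas are the
  heart of the proof.  If all the differences vanish, so do the quadratic forms, and hence the axioms
  of the bialgebra hold.  Conversely, a quadratic form that vanishes identically vanishes at all
  points with coordinates 0 and 1, and this forces the differences to vanish one after another.
  That \<open>k[\<partial>] \<otimes> A\<close> is a Leibniz conformal algebra is proved by the same method
  (\<open>lambda_product_jacobi\<close>).
\<close>

section \<open>Evaluating polynomials with vector coefficients at scalars\<close>

text \<open>The operator substituted for the indeterminate is scalar multiplication by \<open>x\<close>, so this is the
  value of \<open>p\<close> at \<open>x\<close>.\<close>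

definition ev :: "('k::field \<Rightarrow> 'v::ab_group_add \<Rightarrow> 'v) \<Rightarrow> 'k \<Rightarrow> 'v poly \<Rightarrow> 'v" where
  "ev s x = poly_subst id (s x)"

lemma poly_subst_pCons:
  fixes X :: "'m::comm_monoid_add \<Rightarrow> 'm"
  assumes e: "e 0 = 0" and X: "\<And>m n. X (m + n) = X m + X n" "X 0 = 0"
  shows "poly_subst e X (pCons a p) = e a + X (poly_subst e X p)"
proof -
  have X_sum: "X (sum f I) = (\<Sum>i\<in>I. X (f i))" for f and I :: "nat set"
    by (induction I rule: infinite_finite_induct) (auto simp: X)
  show ?thesis
  proof (cases "p = 0")
    case True
    then show ?thesis by (simp add: poly_subst_def e X)
  next
    case False
    then show ?thesis
      by (simp add: poly_subst_def X_sum sum.atMost_Suc_shift del: sum.atMost_Suc)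
  qed
qed

lemma poly_subst_0: "e 0 = 0 \<Longrightarrow> poly_subst e X 0 = 0"
  by (simp add: poly_subst_def)

lemma vector_space_poly_scale [simp]: "vector_space s \<Longrightarrow> vector_space (poly_scale s)"
proof -
  assume "vector_space s"
  then interpret V: vector_space s .
  show ?thesis
    by unfold_locales (auto simp: poly_scale_def poly_eq_iff coeff_map_poly
        V.scale_right_distrib V.scale_left_distrib)
qed

declare vector_space_tensor_scale [simp]

lemma poly_scale_simps [simp]:
  assumes "vector_space s"
  shows "poly_scale s c (pCons a p) = pCons (s c a) (poly_scale s c p)"
    and "poly_scale s c 0 = 0"
    and "coeff (poly_scale s c p) n = s c (coeff p n)"
proof -
  interpret V: vector_space s by fact
  show "poly_scale s c (pCons a p) = pCons (s c a) (poly_scale s c p)"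
    by (simp add: poly_scale_def map_poly_pCons)
  show "poly_scale s c 0 = 0"
    by (simp add: poly_scale_def)
  show "coeff (poly_scale s c p) n = s c (coeff p n)"
    by (simp add: poly_scale_def coeff_map_poly)
qed

lemma
  assumes "Vector_Spaces.linear s s' f"
  shows linear_add: "f (x + y) = f x + f y"
    and linear_scale: "f (s c x) = s' c (f x)"
    and linear_minus: "f (x - y) = f x - f y"
    and linear_neg: "f (- x) = - f x"
proof -
  interpret Vector_Spaces.linear s s' f by fact
  show "f (x + y) = f x + f y" "f (s c x) = s' c (f x)" "f (x - y) = f x - f y" "f (- x) = - f x"
    by (simp_all add: add scale diff neg)
qed

lemma
  assumes "vector_space s"
  shows ev_pCons: "ev s x (pCons a p) = a + s x (ev s x p)"
    and ev_0: "ev s x 0 = 0"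
    and ev_const: "ev s x [:a:] = a"
proof -
  interpret V: vector_space s by fact
  show *: "ev s x (pCons a p) = a + s x (ev s x p)" for a p
    by (simp add: ev_def poly_subst_pCons V.scale_right_distrib)
  show 0: "ev s x 0 = 0"
    by (simp add: ev_def poly_subst_0)
  show "ev s x [:a:] = a"
    by (simp add: * 0)
qed

lemma linear_ev:
  assumes "vector_space s"
  shows "Vector_Spaces.linear (poly_scale s) s (ev s x)"
proof -
  interpret V: vector_space s by fact
  have "ev s x (p + q) = ev s x p + ev s x q" for p q
    by (induction p q rule: poly_induct2)
      (simp_all add: ev_pCons[OF assms] ev_0[OF assms] V.scale_right_distrib algebra_simps)
  moreover have "ev s x (poly_scale s c p) = s c (ev s x p)" for c p
    by (induction p) (simp_all add: assms ev_pCons ev_0 V.scale_right_distrib mult.commute)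
  ultimately show ?thesis
    using assms by (simp add: Vector_Spaces.linear_iff)
qed

lemma ev_map_poly:
  assumes f: "Vector_Spaces.linear s s' f"
  shows "ev s' x (map_poly f p) = f (ev s x p)"
proof -
  have "vector_space s" "vector_space s'"
    using f by (simp_all add: Vector_Spaces.linear_iff)
  then show ?thesis
    by (induction p) (simp_all add: ev_0 ev_pCons map_poly_pCons linear_at_0[OF f]
        linear_add[OF f] linear_scale[OF f])
qed

lemma vector_space_field [simp]: "vector_space ((*) :: 'k::field \<Rightarrow> 'k \<Rightarrow> 'k)"
  by unfold_locales (simp_all add: algebra_simps)

lemma ev_field: "ev (*) x p = poly p x"
  by (induction p) (simp_all add: ev_0 ev_pCons)

text \<open>Why substitution of an operator can be replaced by substitution of a scalar: if \<open>g\<close> turns \<open>X\<close> into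
  multiplication by \<open>c\<close>, then \<open>g\<close> turns the result of substituting \<open>X\<close> into the value at \<open>c\<close>.  The
  invariant \<open>I\<close> is there because an operator like \<open>\<partial> \<otimes> id\<close> behaves as a scalar only on tensors and
  not on arbitrary functions of two functionals.\<close>

lemma eval_poly_subst:
  assumes lin: "vector_space s" "Vector_Spaces.linear s s'' h"
    and e: "e 0 = 0" and X: "\<And>m n. X (m + n) = X m + X n" "X 0 = 0"
    and g: "\<And>m n. g (m + n) = g m + g n" "g 0 = 0"
    and I: "I 0" "\<And>m n. I m \<Longrightarrow> I n \<Longrightarrow> I (m + n)" "\<And>m. I m \<Longrightarrow> I (X m)"
    and I_e: "\<And>i. I (e (coeff p i))"
    and gX: "\<And>m. I m \<Longrightarrow> g (X m) = s'' c (g m)"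
    and ge: "\<And>i. g (e (coeff p i)) = h (coeff p i)"
  shows "g (poly_subst e X p) = h (ev s c p) \<and> I (poly_subst e X p)"
  using I_e ge
proof (induction p)
  case 0
  show ?case by (simp add: poly_subst_0 e g I ev_0 lin linear_at_0[OF lin(2)])
next
  case (pCons a p)
  have *: "I (e (coeff p i))" "g (e (coeff p i)) = h (coeff p i)" for i
    using pCons.prems[of "Suc i"] by simp_all
  show ?case
    using pCons.IH[OF *] pCons.prems[of 0] I
    by (simp add: poly_subst_pCons[where e = e and X = X, OF e X] g ev_pCons lin gX
        linear_add[OF lin(2)] linear_scale[OF lin(2)])
qed

lemma eq_0_if_functionals_0:
  fixes v :: "'v::ab_group_add"
  assumes "vector_space (s :: 'k::field \<Rightarrow> 'v \<Rightarrow> 'v)"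
    and 0: "\<And>f. Vector_Spaces.linear s (*) f \<Longrightarrow> f v = 0"
  shows "v = 0"
proof (rule ccontr)
  assume "v \<noteq> 0"
  interpret V: vector_space s by fact
  interpret P: vector_space_pair s "(*) :: 'k \<Rightarrow> 'k \<Rightarrow> 'k"
    by (simp add: vector_space_pair_def assms)
  have "V.independent {v}"
    using \<open>v \<noteq> 0\<close> by simp
  then obtain f where "Vector_Spaces.linear s (*) f" "\<forall>w\<in>{v}. f w = 1"
    using P.linear_independent_extend[of "{v}" "\<lambda>_. 1"] by blast
  then show False using 0[of f] by simp
qed

text \<open>A functional \<open>f\<close> turns the values of \<open>p\<close> into those of a polynomial over the field; as the
  field is infinite, this polynomial is zero, so every \<open>f\<close> vanishes on all the coefficients.\<close>

lemma eq_0_if_ev_0: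
  fixes p :: "'v::ab_group_add poly"
  assumes "vector_space (s :: 'k::field_char_0 \<Rightarrow> 'v \<Rightarrow> 'v)"
    and 0: "\<And>f x. Vector_Spaces.linear s (*) f \<Longrightarrow> f (ev s x p) = 0"
  shows "p = 0"
proof (rule poly_eqI)
  fix n
  have "f (coeff p n) = 0" if f: "Vector_Spaces.linear s (*) f" for f
  proof -
    have "poly (map_poly f p) x = 0" for x
      using 0[OF f, of x] ev_map_poly[OF f, of x p] by (simp add: ev_field)
    then have "map_poly f p = 0"
      using poly_all_0_iff_0 by blast
    then show ?thesis
      using linear_at_0[OF f] by (metis coeff_0 coeff_map_poly)
  qed
  then show "coeff p n = coeff 0 n"
    using eq_0_if_functionals_0[OF assms(1)] by simp
qed

section \<open>Tensors as forms\<close>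

text \<open>A tensor with all arguments but one fixed is a function of one functional.  Such a function is
  evaluation at a vector, extended by 0 to arguments that are not linear; this is what makes it
  possible to test tensors one argument at a time, without bases.\<close>

definition from_vector ::
    "('k::field \<Rightarrow> 'v::ab_group_add \<Rightarrow> 'v) \<Rightarrow> (('v \<Rightarrow> 'k) \<Rightarrow> 'k) \<Rightarrow> bool" where
  "from_vector s F \<longleftrightarrow> (\<exists>w. \<forall>\<Phi>. F \<Phi> = (if Vector_Spaces.linear s (*) \<Phi> then \<Phi> w else 0))"

lemma from_vector_0:
  assumes "vector_space (s :: 'k::field \<Rightarrow> 'v::ab_group_add \<Rightarrow> 'v)"
  shows "from_vector s (\<lambda>_. 0)"
  unfolding from_vector_def by (rule exI[of _ 0]) (auto simp: linear_at_0)

lemma from_vector_add: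
  assumes "from_vector s F" "from_vector s G"
  shows "from_vector s (\<lambda>\<Phi>. F \<Phi> + G \<Phi>)"
proof -
  obtain v w where "\<forall>\<Phi>. F \<Phi> = (if Vector_Spaces.linear s (*) \<Phi> then \<Phi> v else 0)"
    "\<forall>\<Phi>. G \<Phi> = (if Vector_Spaces.linear s (*) \<Phi> then \<Phi> w else 0)"
    using assms unfolding from_vector_def by blast
  then show ?thesis
    unfolding from_vector_def by (intro exI[of _ "v + w"]) (auto simp: linear_add)
qed

lemma from_vector_diff:
  assumes "from_vector s F" "from_vector s G"
  shows "from_vector s (\<lambda>\<Phi>. F \<Phi> - G \<Phi>)"
proof -
  obtain v w where "\<forall>\<Phi>. F \<Phi> = (if Vector_Spaces.linear s (*) \<Phi> then \<Phi> v else 0)"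
    "\<forall>\<Phi>. G \<Phi> = (if Vector_Spaces.linear s (*) \<Phi> then \<Phi> w else 0)"
    using assms unfolding from_vector_def by blast
  then show ?thesis
    unfolding from_vector_def by (intro exI[of _ "v - w"]) (auto simp: linear_minus)
qed

lemma from_vector_scale:
  assumes "from_vector s F"
  shows "from_vector s (\<lambda>\<Phi>. F \<Phi> * c)"
proof -
  obtain w where "\<forall>\<Phi>. F \<Phi> = (if Vector_Spaces.linear s (*) \<Phi> then \<Phi> w else 0)"
    using assms unfolding from_vector_def by blast
  then show ?thesis
    unfolding from_vector_def by (intro exI[of _ "s c w"]) (auto simp: linear_scale)
qed

lemma linear_functional_simps [simp]:
  fixes s :: "'k::field \<Rightarrow> 'v::ab_group_add \<Rightarrow> 'v" and f g :: "'v \<Rightarrow> 'k"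
  assumes "Vector_Spaces.linear s (*) f"
  shows "Vector_Spaces.linear s (*) g \<Longrightarrow> Vector_Spaces.linear s (*) (\<lambda>v. f v + g v)"
    and "Vector_Spaces.linear s (*) g \<Longrightarrow> Vector_Spaces.linear s (*) (\<lambda>v. f v - g v)"
    and "Vector_Spaces.linear s (*) (\<lambda>v. - f v)"
    and "Vector_Spaces.linear s (*) (\<lambda>v. c * f v)"
  using assms by (auto simp: Vector_Spaces.linear_iff algebra_simps)

lemma linear_functional_0 [simp]:
  "vector_space s \<Longrightarrow> Vector_Spaces.linear s ((*) :: 'k::field \<Rightarrow> 'k \<Rightarrow> 'k) (\<lambda>_. 0)"
  by (simp add: Vector_Spaces.linear_iff)

lemma from_vector_simps:
  fixes s :: "'k::field \<Rightarrow> 'v::ab_group_add \<Rightarrow> 'v"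
  assumes F: "from_vector s F" and s: "vector_space s"
  shows "Vector_Spaces.linear s (*) f \<Longrightarrow> Vector_Spaces.linear s (*) g
      \<Longrightarrow> F (\<lambda>v. f v + g v) = F f + F g"
    and "Vector_Spaces.linear s (*) f \<Longrightarrow> Vector_Spaces.linear s (*) g
      \<Longrightarrow> F (\<lambda>v. f v - g v) = F f - F g"
    and "Vector_Spaces.linear s (*) f \<Longrightarrow> F (\<lambda>v. - f v) = - F f"
    and "Vector_Spaces.linear s (*) f \<Longrightarrow> F (\<lambda>v. c * f v) = c * F f"
    and "\<not> Vector_Spaces.linear s (*) f \<Longrightarrow> F f = 0"
    and "F (\<lambda>_. 0) = 0"
proof -
  obtain w where "\<And>\<Phi>. F \<Phi> = (if Vector_Spaces.linear s (*) \<Phi> then \<Phi> w else 0)"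
    using F unfolding from_vector_def by blast
  then show "Vector_Spaces.linear s (*) f \<Longrightarrow> Vector_Spaces.linear s (*) g
      \<Longrightarrow> F (\<lambda>v. f v + g v) = F f + F g"
    and "Vector_Spaces.linear s (*) f \<Longrightarrow> Vector_Spaces.linear s (*) g
      \<Longrightarrow> F (\<lambda>v. f v - g v) = F f - F g"
    and "Vector_Spaces.linear s (*) f \<Longrightarrow> F (\<lambda>v. - f v) = - F f"
    and "Vector_Spaces.linear s (*) f \<Longrightarrow> F (\<lambda>v. c * f v) = c * F f"
    and "\<not> Vector_Spaces.linear s (*) f \<Longrightarrow> F f = 0"
    and "F (\<lambda>_. 0) = 0"
    using s by simp_all
qed

lemma linear_ev_functional [simp]:
  assumes "vector_space s" "Vector_Spaces.linear s (*) f"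
  shows "Vector_Spaces.linear (poly_scale s) (*) (\<lambda>p. f (ev s x p))"
  using linear_comp[OF linear_ev[OF assms(1)] assms(2)] .

text \<open>The functionals \<open>p \<mapsto> f (p(x))\<close> separate the vectors of \<open>V[\<partial>]\<close>, though in general they span
  only a part of the dual space.\<close>

lemma from_vector_poly_eq_0:
  fixes s :: "'k::field_char_0 \<Rightarrow> 'v::ab_group_add \<Rightarrow> 'v"
  assumes s: "vector_space s" and F: "from_vector (poly_scale s) F"
    and 0: "\<And>f x. Vector_Spaces.linear s (*) f \<Longrightarrow> F (\<lambda>p. f (ev s x p)) = 0"
  shows "F \<Phi> = 0"
proof -
  obtain w where w: "\<And>\<Phi>. F \<Phi> = (if Vector_Spaces.linear (poly_scale s) (*) \<Phi> then \<Phi> w else 0)"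
    using F unfolding from_vector_def by blast
  have "w = 0"
    by (rule eq_0_if_ev_0[OF s]) (use 0 in \<open>simp add: w s\<close>)
  then show ?thesis by (simp add: w linear_at_0)
qed

lemma tensor_space_closed [simp]:
  fixes s :: "'k::field \<Rightarrow> 'v::ab_group_add \<Rightarrow> 'v"
  shows "pure2 s v w \<in> tensor_space s"
    and "0 \<in> tensor_space s"
    and "T \<in> tensor_space s \<Longrightarrow> T' \<in> tensor_space s \<Longrightarrow> T + T' \<in> tensor_space s"
    and "T \<in> tensor_space s \<Longrightarrow> T' \<in> tensor_space s \<Longrightarrow> T - T' \<in> tensor_space s"
    and "T \<in> tensor_space s \<Longrightarrow> - T \<in> tensor_space s"
    and "T \<in> tensor_space s \<Longrightarrow> tensor_scale c T \<in> tensor_space s"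
proof -
  interpret T: vector_space "tensor_scale :: 'k \<Rightarrow> ('k, 'v) tensor2 \<Rightarrow> _" by simp
  show "pure2 s v w \<in> tensor_space s"
    and "0 \<in> tensor_space s"
    and "T \<in> tensor_space s \<Longrightarrow> T' \<in> tensor_space s \<Longrightarrow> T + T' \<in> tensor_space s"
    and "T \<in> tensor_space s \<Longrightarrow> T' \<in> tensor_space s \<Longrightarrow> T - T' \<in> tensor_space s"
    and "T \<in> tensor_space s \<Longrightarrow> - T \<in> tensor_space s"
    and "T \<in> tensor_space s \<Longrightarrow> tensor_scale c T \<in> tensor_space s"
    unfolding tensor_space_def
    by (auto intro: T.span_zero T.span_add T.span_diff T.span_neg T.span_scale T.span_base)
qed

lemma tensor_induct [consumes 2, case_names zero pure add]:
  assumes "vector_space s" "T \<in> tensor_space s"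
    and "P 0" "\<And>v w. P (pure2 s v w)"
    and add: "\<And>T T'. T \<in> tensor_space s \<Longrightarrow> T' \<in> tensor_space s \<Longrightarrow> P T \<Longrightarrow> P T' \<Longrightarrow> P (T + T')"
  shows "P T"
proof -
  obtain n :: nat and x y where T: "T = (\<Sum>i<n. pure2 s (x i) (y i))"
    using tensor2_cases[OF assms(1,2)] by metis
  have "(\<Sum>i<m. pure2 s (x i) (y i)) \<in> tensor_space s \<and> P (\<Sum>i<m. pure2 s (x i) (y i))" for m :: nat
    by (induction m) (auto intro: assms simp del: plus_fun_apply zero_fun_apply)
  then show ?thesis by (simp add: T)
qed

lemma from_vector_tensor:
  assumes s: "vector_space s" and T: "T \<in> tensor_space s"
  shows "from_vector s (\<lambda>\<Phi>. T \<Phi> \<Psi>)" "from_vector s (\<lambda>\<Psi>. T \<Phi> \<Psi>)"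
proof -
  have "from_vector s (\<lambda>\<Phi>. T \<Phi> \<Psi>) \<and> from_vector s (\<lambda>\<Psi>. T \<Phi> \<Psi>)"
    using s T
  proof (induction rule: tensor_induct)
    case zero
    show ?case by (simp add: from_vector_0 s)
  next
    case (pure v w)
    have "from_vector s (\<lambda>\<Phi>. pure2 s v w \<Phi> \<Psi>)"
      unfolding from_vector_def
      by (rule exI[of _ "if Vector_Spaces.linear s (*) \<Psi> then s (\<Psi> w) v else 0"])
        (auto simp: pure2_def linear_scale linear_at_0)
    moreover have "from_vector s (\<lambda>\<Psi>. pure2 s v w \<Phi> \<Psi>)"
      unfolding from_vector_def
      by (rule exI[of _ "if Vector_Spaces.linear s (*) \<Phi> then s (\<Phi> v) w else 0"])
        (auto simp: pure2_def linear_scale linear_at_0)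
    ultimately show ?case ..
  next
    case (add T T')
    then show ?case by (simp add: from_vector_add)
  qed
  then show "from_vector s (\<lambda>\<Phi>. T \<Phi> \<Psi>)" "from_vector s (\<lambda>\<Psi>. T \<Phi> \<Psi>)" by auto
qed

lemma tensor_space_map:
  assumes f: "Vector_Spaces.linear s s' f" and g: "Vector_Spaces.linear s s' g"
    and T: "T \<in> tensor_space s"
  shows "tensor_map s' f g T \<in> tensor_space s'"
proof -
  have "vector_space s" using f by (simp add: Vector_Spaces.linear_iff)
  then show ?thesis
    using T by (induction rule: tensor_induct)
      (simp_all add: linear_at_0[OF linear_tensor_map] linear_add[OF linear_tensor_map]
        tensor_map_pure2[OF f g] del: plus_fun_apply zero_fun_apply)
qed

lemma flip_simps [simp]:
  "flip (T + T') = flip T + flip T'" "flip (T - T') = flip T - flip T'" "flip 0 = 0"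
  by (simp_all add: flip_def fun_eq_iff)

lemma linear_flip: "Vector_Spaces.linear tensor_scale tensor_scale flip"
  by (simp add: Vector_Spaces.linear_iff) (simp add: flip_def tensor_scale_def)

lemma tensor_space_flip [simp]:
  assumes "vector_space s" "T \<in> tensor_space s"
  shows "flip T \<in> tensor_space s"
  using assms by (induction rule: tensor_induct) (simp_all add: flip_pure del: plus_fun_apply zero_fun_apply)

text \<open>The test functionals separate tensors: move the two arguments one after the other from test
  functionals to arbitrary ones.\<close>

lemma tensor_poly_eqI:
  fixes s :: "'k::field_char_0 \<Rightarrow> 'v::ab_group_add \<Rightarrow> 'v"
  assumes s: "vector_space s"
    and T: "T \<in> tensor_space (poly_scale s)" "T' \<in> tensor_space (poly_scale s)"
    and eq: "\<And>f g x y. Vector_Spaces.linear s (*) f \<Longrightarrow> Vector_Spaces.linear s (*) g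
      \<Longrightarrow> T (\<lambda>p. f (ev s x p)) (\<lambda>p. g (ev s y p)) = T' (\<lambda>p. f (ev s x p)) (\<lambda>p. g (ev s y p))"
  shows "T = T'"
proof (intro ext)
  fix \<Phi> \<Psi>
  note fv = from_vector_tensor[OF vector_space_poly_scale[OF s] tensor_space_closed(4)[OF T]]
  have "(T - T') (\<lambda>p. f (ev s x p)) \<Psi> = 0" if "Vector_Spaces.linear s (*) f" for f x
    by (rule from_vector_poly_eq_0[OF s fv(2)]) (use eq that in simp)
  then have "(T - T') \<Phi> \<Psi> = 0"
    by (rule from_vector_poly_eq_0[OF s fv(1)])
  then show "T \<Phi> \<Psi> = T' \<Phi> \<Psi>" by simp
qed

section \<open>Polynomials with tensor coefficients\<close>

definition tensor_poly ::
    "('k::field \<Rightarrow> 'q::ab_group_add \<Rightarrow> 'q) \<Rightarrow> ('k, 'q) tensor2 poly \<Rightarrow> bool" where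
  "tensor_poly s P \<longleftrightarrow> (\<forall>n. coeff P n \<in> tensor_space s)"

lemma tensor_poly_closed [simp]:
  shows "tensor_poly s 0"
    and "tensor_poly s P \<Longrightarrow> tensor_poly s P' \<Longrightarrow> tensor_poly s (P + P')"
    and "tensor_poly s P \<Longrightarrow> tensor_poly s P' \<Longrightarrow> tensor_poly s (P - P')"
    and "tensor_poly s P \<Longrightarrow> tensor_poly s (- P)"
    and "T \<in> tensor_space s \<Longrightarrow> tensor_poly s P \<Longrightarrow> tensor_poly s (pCons T P)"
  by (auto simp: tensor_poly_def coeff_pCons split: nat.splits)

lemma tensor_poly_map:
  assumes "tensor_poly s P" "f 0 = 0" "\<And>T. T \<in> tensor_space s \<Longrightarrow> f T \<in> tensor_space s'"
  shows "tensor_poly s' (map_poly f P)"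
  using assms by (simp add: tensor_poly_def coeff_map_poly)

lemma tensor_space_ev:
  assumes "tensor_poly s P"
  shows "ev tensor_scale l P \<in> tensor_space s"
  using assms
proof (induction P)
  case (pCons T P)
  then have "coeff (pCons T P) n \<in> tensor_space s" for n
    by (simp add: tensor_poly_def)
  from this[of 0] this[of "Suc _"] have "T \<in> tensor_space s" "tensor_poly s P"
    by (simp_all add: tensor_poly_def)
  with pCons show ?case by (simp add: ev_pCons del: plus_fun_apply)
qed (simp add: ev_0)

lemma poly_of_tensors_eqI:
  fixes s :: "'k::field_char_0 \<Rightarrow> 'v::ab_group_add \<Rightarrow> 'v"
  assumes s: "vector_space s"
    and P: "tensor_poly (poly_scale s) P" "tensor_poly (poly_scale s) P'"
    and eq: "\<And>f g x y l. Vector_Spaces.linear s (*) f \<Longrightarrow> Vector_Spaces.linear s (*) g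
      \<Longrightarrow> ev tensor_scale l P (\<lambda>p. f (ev s x p)) (\<lambda>p. g (ev s y p))
        = ev tensor_scale l P' (\<lambda>p. f (ev s x p)) (\<lambda>p. g (ev s y p))"
  shows "P = P'"
proof -
  have "ev tensor_scale l P = ev tensor_scale l P'" for l
    by (rule tensor_poly_eqI[OF s tensor_space_ev tensor_space_ev]) (use P eq in auto)
  then have "ev tensor_scale l (P - P') = 0" for l
    by (simp add: linear_minus[OF linear_ev])
  then have "P - P' = 0"
    by (intro eq_0_if_ev_0[of tensor_scale]) (simp_all add: linear_at_0)
  then show ?thesis by simp
qed

lemma linear_tensor_apply: "Vector_Spaces.linear tensor_scale (*) (\<lambda>T. T \<Phi> \<Psi>)"
  by (simp add: Vector_Spaces.linear_iff) (simp add: tensor_scale_def)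

lemma map_poly_add:
  assumes "\<And>x y. f (x + y) = f x + f y" "f 0 = 0"
  shows "map_poly f (p + q) = map_poly f p + map_poly f q"
  by (rule poly_eqI) (simp add: coeff_map_poly assms)

text \<open>The common form of the substitutions \<open>\<plusminus>\<lambda> - f\<close>, where \<open>f\<close> is a coefficient operator
  with eigenvalue \<open>x\<close> at the functionals under consideration.  \<open>Y\<close> is multiplication by \<open>\<plusminus>\<lambda>\<close> and \<open>c\<close>
  is the value of \<open>\<plusminus>\<lambda>\<close> at \<open>\<lambda> = l\<close>.\<close>

lemma ev_subst_tensor:
  fixes X :: "('k::field, 'q::ab_group_add) tensor2 poly \<Rightarrow> _"
  assumes X: "\<And>P. X P = Y P - map_poly f P"
    and Y: "Y = pCons 0 \<and> c = l \<or> Y = (\<lambda>P. - pCons 0 P) \<and> c = - l"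
    and f: "Vector_Spaces.linear tensor_scale tensor_scale f"
    and f_space: "\<And>T. T \<in> tensor_space s \<Longrightarrow> f T \<in> tensor_space s"
    and f_eigen: "\<And>T. T \<in> tensor_space s \<Longrightarrow> f T \<Phi> \<Psi> = x * T \<Phi> \<Psi>"
    and P: "tensor_poly s P"
  shows "ev tensor_scale l (poly_subst const_poly X P) \<Phi> \<Psi> = ev tensor_scale (c - x) P \<Phi> \<Psi>"
    and "tensor_poly s (poly_subst const_poly X P)"
proof -
  note ev_lin = linear_add[OF linear_ev[OF vector_space_tensor_scale]]
    linear_minus[OF linear_ev[OF vector_space_tensor_scale]]
    linear_neg[OF linear_ev[OF vector_space_tensor_scale]]
  have "ev tensor_scale l (poly_subst const_poly X P) \<Phi> \<Psi> = ev tensor_scale (c - x) P \<Phi> \<Psi>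
      \<and> tensor_poly s (poly_subst const_poly X P)"
  proof (rule eval_poly_subst[where g = "\<lambda>R. ev tensor_scale l R \<Phi> \<Psi>" and h = "\<lambda>T. T \<Phi> \<Psi>"])
    show "Vector_Spaces.linear tensor_scale (*) (\<lambda>T::('k, 'q) tensor2. T \<Phi> \<Psi>)"
      by (rule linear_tensor_apply)
    show "tensor_poly s (X m)" if "tensor_poly s m" for m
      using Y tensor_poly_map[where f = f, OF that linear_at_0[OF f] f_space] that by (auto simp: X)
    show "ev tensor_scale l (X m) \<Phi> \<Psi> = (c - x) * ev tensor_scale l m \<Phi> \<Psi>" if "tensor_poly s m" for m
      using Y by (auto simp: X ev_lin ev_map_poly[OF f] ev_pCons f_eigen[OF tensor_space_ev[OF that]]
          tensor_scale_def algebra_simps)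
    show "X (m + n) = X m + X n" for m n
      using Y by (auto simp: X map_poly_add linear_add[OF f] linear_at_0[OF f])
    show "X 0 = 0" using Y by (auto simp: X)
    show "tensor_poly s [:coeff P i:]" for i
      using P by (auto simp: tensor_poly_def coeff_pCons split: nat.splits)
  qed (simp_all add: ev_lin ev_0 ev_const)
  then show "ev tensor_scale l (poly_subst const_poly X P) \<Phi> \<Psi> = ev tensor_scale (c - x) P \<Phi> \<Psi>"
    and "tensor_poly s (poly_subst const_poly X P)" by auto
qed

text \<open>Evaluating \<open>\<lambda>\<close> commutes with applying \<open>F \<otimes> id\<close>; on tensors the effect is to compose one argument
  with \<open>v \<mapsto> F(v)(l)\<close>.\<close>

lemma
  assumes s: "vector_space s" and F: "Vector_Spaces.linear s (poly_scale s) F"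
    and T: "T \<in> tensor_space s"
  shows tensor_poly_left: "tensor_poly s (poly_tensor_left s F T)"
    and tensor_poly_right: "tensor_poly s (poly_tensor_right s F T)"
    and ev_poly_tensor_left: "Vector_Spaces.linear s (*) \<Phi> \<Longrightarrow> Vector_Spaces.linear s (*) \<Psi>
      \<Longrightarrow> ev tensor_scale l (poly_tensor_left s F T) \<Phi> \<Psi> = T (\<lambda>v. \<Phi> (ev s l (F v))) \<Psi>"
    and ev_poly_tensor_right: "Vector_Spaces.linear s (*) \<Phi> \<Longrightarrow> Vector_Spaces.linear s (*) \<Psi>
      \<Longrightarrow> ev tensor_scale l (poly_tensor_right s F T) \<Phi> \<Psi> = T \<Phi> (\<lambda>v. \<Psi> (ev s l (F v)))"
proof -
  have F_coeff: "Vector_Spaces.linear s s (\<lambda>v. coeff (F v) n)" for n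
    using F s by (simp add: Vector_Spaces.linear_iff)
  have id: "Vector_Spaces.linear s s id"
    by (rule vector_space.linear_id[OF s])
  note coeffs = coeff_poly_tensor[OF s F]
  show "tensor_poly s (poly_tensor_left s F T)" "tensor_poly s (poly_tensor_right s F T)"
    unfolding tensor_poly_def coeffs[OF T] by (auto intro: tensor_space_map F_coeff id T)
  assume \<Phi>: "Vector_Spaces.linear s (*) \<Phi>" and \<Psi>: "Vector_Spaces.linear s (*) \<Psi>"
  have evF: "Vector_Spaces.linear s (*) (\<lambda>v. \<chi> (ev s l (F v)))" if "Vector_Spaces.linear s (*) \<chi>" for \<chi>
    using linear_comp[OF linear_comp[OF F linear_ev[OF s]] that] .
  have "ev tensor_scale l (poly_tensor_left s F T) \<Phi> \<Psi> = T (\<lambda>v. \<Phi> (ev s l (F v))) \<Psi>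
      \<and> ev tensor_scale l (poly_tensor_right s F T) \<Phi> \<Psi> = T \<Phi> (\<lambda>v. \<Psi> (ev s l (F v)))"
    using s T
  proof (induction rule: tensor_induct)
    case zero
    have "poly_tensor_left s F 0 = 0" "poly_tensor_right s F 0 = 0"
      by (rule poly_eqI; simp add: coeffs linear_at_0[OF linear_tensor_map])+
    then show ?case by (simp add: ev_0 del: zero_fun_apply) simp
  next
    case (pure v w)
    have "poly_tensor_left s F (pure2 s v w) = map_poly (\<lambda>u. pure2 s u w) (F v)"
      "poly_tensor_right s F (pure2 s v w) = map_poly (\<lambda>u. pure2 s v u) (F w)"
      by (rule poly_eqI; simp add: coeffs coeff_map_poly linear_at_0[OF linear_pure2(1)[OF s]]
          linear_at_0[OF linear_pure2(2)[OF s]] tensor_map_pure2[OF F_coeff id]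
          tensor_map_pure2[OF id F_coeff])+
    then show ?case
      by (simp add: ev_map_poly[OF linear_pure2(1)[OF s]] ev_map_poly[OF linear_pure2(2)[OF s]])
        (simp add: pure2_def \<Phi> \<Psi> evF)
  next
    case (add T T')
    have "poly_tensor_left s F (T + T') = poly_tensor_left s F T + poly_tensor_left s F T'"
      "poly_tensor_right s F (T + T') = poly_tensor_right s F T + poly_tensor_right s F T'"
      by (rule poly_eqI; simp add: coeffs add linear_add[OF linear_tensor_map])+
    then show ?case
      using add by (simp add: linear_add[OF linear_ev[OF vector_space_tensor_scale]] del: plus_fun_apply) simp
  qed
  then show "ev tensor_scale l (poly_tensor_left s F T) \<Phi> \<Psi> = T (\<lambda>v. \<Phi> (ev s l (F v))) \<Psi>"
    and "ev tensor_scale l (poly_tensor_right s F T) \<Phi> \<Psi> = T \<Phi> (\<lambda>v. \<Psi> (ev s l (F v)))" by auto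
qed

section \<open>Tensor cubes\<close>

text \<open>All that is used of a tensor of order three is that each of its three one-argument restrictions
  is evaluation at a vector.\<close>

definition trilinear_form ::
    "('k::field \<Rightarrow> 'v::ab_group_add \<Rightarrow> 'v) \<Rightarrow> ('k, 'v) tensor3 \<Rightarrow> bool" where
  "trilinear_form s T \<longleftrightarrow> (\<forall>\<Phi> \<Psi> \<Theta>. from_vector s (\<lambda>\<Phi>. T \<Phi> \<Psi> \<Theta>) \<and> from_vector s (\<lambda>\<Psi>. T \<Phi> \<Psi> \<Theta>)
    \<and> from_vector s (\<lambda>\<Theta>. T \<Phi> \<Psi> \<Theta>))"

lemma trilinear_form_closed [simp]:
  shows "trilinear_form s T \<Longrightarrow> trilinear_form s T' \<Longrightarrow> trilinear_form s (T + T')"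
    and "trilinear_form s T \<Longrightarrow> trilinear_form s T' \<Longrightarrow> trilinear_form s (T - T')"
    and "trilinear_form s T \<Longrightarrow> trilinear_form s (flip12 T)"
  by (simp_all add: trilinear_form_def from_vector_add from_vector_diff flip12_def)

text \<open>The test functionals separate tensors of order three, for the same reason as those of order
  two.\<close>

lemma trilinear_form_poly_eq_0:
  fixes s :: "'k::field_char_0 \<Rightarrow> 'v::ab_group_add \<Rightarrow> 'v"
  assumes s: "vector_space s" and T: "trilinear_form (poly_scale s) T"
    and 0: "\<And>f g h x y z. Vector_Spaces.linear s (*) f \<Longrightarrow> Vector_Spaces.linear s (*) g
      \<Longrightarrow> Vector_Spaces.linear s (*) h
      \<Longrightarrow> T (\<lambda>p. f (ev s x p)) (\<lambda>p. g (ev s y p)) (\<lambda>p. h (ev s z p)) = 0"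
  shows "T = 0"
proof (intro ext)
  fix \<Phi> \<Psi> \<Theta>
  note T' = T[unfolded trilinear_form_def, rule_format]
  have "T (\<lambda>p. f (ev s x p)) (\<lambda>p. g (ev s y p)) \<Theta> = 0"
    if "Vector_Spaces.linear s (*) f" "Vector_Spaces.linear s (*) g" for f g x y
    by (rule from_vector_poly_eq_0[OF s]) (use T' 0 that in auto)
  then have "T (\<lambda>p. f (ev s x p)) \<Psi> \<Theta> = 0" if "Vector_Spaces.linear s (*) f" for f x
    by (rule from_vector_poly_eq_0[OF s, rotated]) (use T' that in auto)
  then have "T \<Phi> \<Psi> \<Theta> = 0"
    by (rule from_vector_poly_eq_0[OF s, rotated]) (use T' in auto)
  then show "T \<Phi> \<Psi> \<Theta> = 0 \<Phi> \<Psi> \<Theta>" by simp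
qed

lemma trilinear_form_cop:
  assumes s: "vector_space s" and d: "Vector_Spaces.linear s tensor_scale d"
    and d_space: "\<And>v. d v \<in> tensor_space s" and T: "T \<in> tensor_space s"
  shows "trilinear_form s (cop_left d T)" "trilinear_form s (cop_right d T)"
proof -
  have lin: "Vector_Spaces.linear s (*) (\<lambda>v. d v \<Phi> \<Psi>)" for \<Phi> \<Psi>
    using linear_comp[OF d linear_tensor_apply] .
  note d_slices = from_vector_tensor[OF s d_space]
  note slices = from_vector_tensor[OF s]
  have d_scaled: "from_vector s (\<lambda>\<Phi>. c * d v \<Phi> \<Psi>)" "from_vector s (\<lambda>\<Psi>. c * d v \<Phi> \<Psi>)" for v c \<Phi> \<Psi>
    using from_vector_scale[OF d_slices(1)] from_vector_scale[OF d_slices(2)]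
    by (simp_all add: mult.commute)
  have "from_vector s (\<lambda>\<Phi>. T (\<lambda>v. d v \<Phi> \<Psi>) \<Theta>) \<and> from_vector s (\<lambda>\<Psi>. T (\<lambda>v. d v \<Phi> \<Psi>) \<Theta>)
      \<and> from_vector s (\<lambda>\<Psi>. T \<Phi> (\<lambda>v. d v \<Psi> \<Theta>)) \<and> from_vector s (\<lambda>\<Theta>. T \<Phi> (\<lambda>v. d v \<Psi> \<Theta>))" for \<Phi> \<Psi> \<Theta>
    using s T
  proof (induction rule: tensor_induct)
    case zero
    show ?case by (simp add: from_vector_0 s)
  next
    case (pure v w)
    show ?case
      by (cases "Vector_Spaces.linear s (*) \<Phi>"; cases "Vector_Spaces.linear s (*) \<Theta>")
        (simp_all add: pure2_def lin from_vector_0 s from_vector_scale d_slices d_scaled)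
  next
    case (add T T')
    then show ?case by (simp add: from_vector_add)
  qed
  then show "trilinear_form s (cop_left d T)" "trilinear_form s (cop_right d T)"
    by (simp_all add: trilinear_form_def cop_left_def cop_right_def slices T)
qed

section \<open>The conformal algebra of a Novikov dialgebra, evaluated\<close>

lemma poly_eqI_ev:
  fixes p q :: "'v::ab_group_add poly"
  assumes s: "vector_space (s :: 'k::field_char_0 \<Rightarrow> 'v \<Rightarrow> 'v)"
    and eq: "\<And>x. ev s x p = ev s x q"
  shows "p = q"
proof -
  have "p - q = 0"
    by (rule eq_0_if_ev_0[OF s]) (simp add: linear_minus[OF linear_ev[OF s]] eq linear_at_0)
  then show ?thesis by simp
qed

lemma linear_sum:
  assumes "Vector_Spaces.linear s s' f"
  shows "f (sum g I) = (\<Sum>i\<in>I. f (g i))"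
  by (induction I rule: infinite_finite_induct)
    (simp_all add: linear_at_0[OF assms] linear_add[OF assms])

lemma ev_eq_sum:
  assumes "vector_space s"
  shows "ev s x p = (\<Sum>i\<le>degree p. s (x ^ i) (coeff p i))"
proof -
  interpret V: vector_space s by fact
  have "(s x ^^ i) v = s (x ^ i) v" for i v
    by (induction i) simp_all
  then show ?thesis by (simp add: ev_def poly_subst_def)
qed

lemma linear_pCons_0: "vector_space s \<Longrightarrow> Vector_Spaces.linear (poly_scale s) (poly_scale s) (pCons 0)"
  by (simp add: Vector_Spaces.linear_iff linear_at_0[OF vector_space.linear_scale_self[of s]]
      vector_space.linear_scale_self)

lemma ev_pCons_0: "vector_space s \<Longrightarrow> ev s x (pCons 0 p) = s x (ev s x p)"
  by (simp add: ev_pCons)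

locale novikov_dialgebra_char_0 = novikov_dialgebra s ld rd
  for s :: "'k::field_char_0 \<Rightarrow> 'a::ab_group_add \<Rightarrow> 'a"
    and ld :: "'a \<Rightarrow> 'a \<Rightarrow> 'a" (infixl \<open>\<stileturn>\<close> 70)
    and rd :: "'a \<Rightarrow> 'a \<Rightarrow> 'a" (infixl \<open>\<turnstile>\<close> 70)
begin

lemma vs [simp]: "vector_space s"
  by unfold_locales

abbreviation sQ where "sQ \<equiv> poly_scale s"
abbreviation br where "br \<equiv> dialgebra_bracket ld rd"

text \<open>The value of \<open>[a \<^sub>l b]\<close> at \<open>\<partial> = x\<close>, for \<open>a\<close> and \<open>b\<close> in \<open>A\<close>.\<close>

definition lambda_product :: "'k \<Rightarrow> 'k \<Rightarrow> 'a \<Rightarrow> 'a \<Rightarrow> 'a" where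
  "lambda_product x l a b = s x (b \<stileturn> a) + s l (a \<turnstile> b + b \<stileturn> a)"

lemmas product_simps =
  linear_add[OF ld_linear_left] linear_add[OF ld_linear_right]
  linear_add[OF rd_linear_left] linear_add[OF rd_linear_right]
  linear_scale[OF ld_linear_left] linear_scale[OF ld_linear_right]
  linear_scale[OF rd_linear_left] linear_scale[OF rd_linear_right]
  scale_right_distrib scale_left_distrib

lemma linear_lambda_product:
  "Vector_Spaces.linear s s (\<lambda>a. lambda_product x l a b)"
  "Vector_Spaces.linear s s (\<lambda>b. lambda_product x l a b)"
  by (simp_all add: Vector_Spaces.linear_iff lambda_product_def product_simps mult.commute add_ac)

lemmas ev_linear_simps =
  linear_add[OF linear_ev] linear_minus[OF linear_ev] linear_neg[OF linear_ev]
  linear_scale[OF linear_ev] linear_at_0[OF linear_ev] ev_pCons_0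

text \<open>In \<open>[\<partial>\<^sup>i a \<^sub>l \<partial>\<^sup>j b]\<close> the powers of \<open>\<partial>\<close> contribute \<open>(-l)\<^sup>i (l + x)\<^sup>j\<close>, so summing over the
  coefficients evaluates the left argument at \<open>-l\<close> and the right one at \<open>l + x\<close>.\<close>

lemma ev_bracket:
  "ev s x (ev sQ l (br p q)) = lambda_product x l (ev s (- l) p) (ev s (l + x) q)"
proof -
  let ?g = "\<lambda>r. ev s x (ev sQ l r)"
  let ?X = "\<lambda>r::'a poly poly. - pCons 0 r"
  let ?Y = "\<lambda>r::'a poly poly. pCons 0 r + map_poly (pCons 0) r"
  have X: "?g ((?X ^^ i) r) = s ((- l) ^ i) (?g r)" for i r
    by (induction i) (simp_all add: ev_linear_simps)
  have Y: "?g ((?Y ^^ i) r) = s ((l + x) ^ i) (?g r)" for i r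
    by (induction i)
      (simp_all add: ev_linear_simps ev_map_poly[OF linear_pCons_0] scale_left_distrib distrib_right)
  have base: "?g (base_bracket ld rd a b) = lambda_product x l a b" for a b
    by (simp add: base_bracket_def lambda_product_def ev_pCons ev_0 ev_linear_simps)
  have "?g (br p q) = (\<Sum>i\<le>degree p. \<Sum>j\<le>degree q.
      s ((- l) ^ i) (s ((l + x) ^ j) (lambda_product x l (coeff p i) (coeff q j))))"
    unfolding dialgebra_bracket_def
    by (simp only: linear_sum[OF linear_ev[OF vector_space_poly_scale[OF vs]]]
        linear_sum[OF linear_ev[OF vs]] X Y base)
  also have "\<dots> = lambda_product x l (ev s (- l) p) (ev s (l + x) q)"
    by (simp add: ev_eq_sum linear_sum[OF linear_lambda_product(1)] linear_sum[OF linear_lambda_product(2)]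
        linear_scale[OF linear_lambda_product(1)] linear_scale[OF linear_lambda_product(2)] scale_sum_right,
        subst sum.swap, simp add: mult.commute)
  finally show ?thesis .
qed

lemma bracket_poly_eqI:
  fixes P P' :: "'a poly poly"
  assumes "\<And>x l. ev s x (ev sQ l P) = ev s x (ev sQ l P')"
  shows "P = P'"
  by (intro poly_eqI_ev[of sQ] poly_eqI_ev[of s]) (simp_all add: assms)

lemma linear_bracket:
  "Vector_Spaces.linear sQ (poly_scale sQ) (\<lambda>p. br p q)"
  "Vector_Spaces.linear sQ (poly_scale sQ) (\<lambda>q. br p q)"
  unfolding Vector_Spaces.linear_iff
  by (auto intro!: bracket_poly_eqI simp: ev_linear_simps ev_bracket
      linear_add[OF linear_lambda_product(1)] linear_add[OF linear_lambda_product(2)]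
      linear_scale[OF linear_lambda_product(1)] linear_scale[OF linear_lambda_product(2)])

lemma ev_cR:
  "ev s x (ev sQ l (cR (pCons 0) br p q)) = lambda_product x (- l - x) (ev s (l + x) q) (ev s (- l) p)"
proof -
  have "ev s x (ev sQ l (cR (pCons 0) br p q)) = ev s x (ev sQ (- l - x) (br q p)) \<and> True"
    unfolding cR_def
    by (rule eval_poly_subst[where g = "\<lambda>r. ev s x (ev sQ l r)" and I = "\<lambda>_. True" and s'' = s])
      (simp_all add: ev_linear_simps ev_map_poly[OF linear_pCons_0] linear_ev ev_const ev_0
        map_poly_add scale_left_diff_distrib)
  then show ?thesis by (simp add: ev_bracket add.commute)
qed

lemma linear_cR: "Vector_Spaces.linear sQ (poly_scale sQ) (cR (pCons 0) br p)"
  unfolding Vector_Spaces.linear_iff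
  by (auto intro!: bracket_poly_eqI simp: ev_linear_simps ev_cR
      linear_add[OF linear_lambda_product(1)] linear_scale[OF linear_lambda_product(1)])

text \<open>The Jacobi identity after evaluation.  Modulo the axioms of a Novikov dialgebra, the twelve kinds
  of triple products that occur reduce to six, and then the scalar coefficients agree.\<close>

lemma lambda_product_jacobi:
  "lambda_product x l a (lambda_product (l + x) m b c)
    = lambda_product x (l + m) (lambda_product (- l - m) l a b) c
    + lambda_product x m b (lambda_product (m + x) l a c)"
proof -
  have "f (lambda_product x l a (lambda_product (l + x) m b c)
    - (lambda_product x (l + m) (lambda_product (- l - m) l a b) c
    + lambda_product x m b (lambda_product (m + x) l a c))) = 0"
    if f: "Vector_Spaces.linear s (*) f" for f
  proof -
    note f_simps = linear_add[OF f] linear_minus[OF f] linear_scale[OF f]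
    \<comment> \<open>The equations are oriented so that they rewrite every triple product to the six chosen ones.\<close>
    have "f ((c \<stileturn> a) \<stileturn> b) = f ((c \<stileturn> b) \<stileturn> a)"
      "f (c \<stileturn> (b \<turnstile> a)) = f (c \<stileturn> (b \<stileturn> a))" "f (c \<stileturn> (a \<turnstile> b)) = f (c \<stileturn> (a \<stileturn> b))"
      "f ((b \<turnstile> a) \<turnstile> c) = f ((b \<turnstile> c) \<stileturn> a)" "f ((b \<stileturn> a) \<turnstile> c) = f ((b \<turnstile> c) \<stileturn> a)"
      "f ((a \<turnstile> b) \<turnstile> c) = f ((a \<turnstile> c) \<stileturn> b)" "f ((a \<stileturn> b) \<turnstile> c) = f ((a \<turnstile> c) \<stileturn> b)"
      by (metis nov1 nov2 nov3 nov4)+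
    moreover from this have
      "f (b \<turnstile> (c \<stileturn> a)) = f ((b \<turnstile> c) \<stileturn> a) - f ((c \<stileturn> b) \<stileturn> a) + f (c \<stileturn> (b \<stileturn> a))"
      "f (a \<turnstile> (c \<stileturn> b)) = f ((a \<turnstile> c) \<stileturn> b) - f ((c \<stileturn> b) \<stileturn> a) + f (c \<stileturn> (a \<stileturn> b))"
      "f (a \<turnstile> (b \<turnstile> c)) = f ((a \<turnstile> c) \<stileturn> b) - f ((b \<turnstile> c) \<stileturn> a) + f (b \<turnstile> (a \<turnstile> c))"
      using arg_cong[OF nov5[of c b a], of f] arg_cong[OF nov5[of c a b], of f]
        arg_cong[OF nov6[of a b c], of f]
      unfolding linear_minus[OF f] by (simp_all add: algebra_simps)
    ultimately show ?thesis
      by (simp add: lambda_product_def product_simps f_simps) (simp add: algebra_simps)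
  qed
  then have "lambda_product x l a (lambda_product (l + x) m b c)
    - (lambda_product x (l + m) (lambda_product (- l - m) l a b) c
    + lambda_product x m b (lambda_product (m + x) l a c)) = 0"
    by (rule eq_0_if_functionals_0[OF vs])
  then show ?thesis by simp
qed

text \<open>This serves the inner brackets of the Jacobi identity: for \<open>\<lambda> = l\<close> and \<open>\<mu> = m\<close> the operators \<open>\<lambda>\<close>,
  \<open>\<mu>\<close> and \<open>\<lambda> + \<mu>\<close> are multiplication by \<open>c = l\<close>, \<open>m\<close> and \<open>l + m\<close>.\<close>

lemma eval_bracket_at:
  assumes X: "\<And>m n. X (m + n) = X m + X n" "X 0 = 0"
    and gX: "\<And>R. ev sQ m (ev (poly_scale sQ) l (X R)) = sQ c (ev sQ m (ev (poly_scale sQ) l R))"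
  shows "ev sQ m (ev (poly_scale sQ) l (bracket_at br X p q)) = ev sQ c (br p q)"
proof -
  have "ev sQ m (ev (poly_scale sQ) l (bracket_at br X p q)) = ev sQ c (br p q) \<and> True"
    unfolding bracket_at_def
    by (rule eval_poly_subst[where g = "\<lambda>r. ev sQ m (ev (poly_scale sQ) l r)" and I = "\<lambda>_. True"
          and s'' = sQ and h = "\<lambda>q. q"])
      (simp_all add: X gX ev_linear_simps ev_const vector_space.linear_ident)
  then show ?thesis ..
qed

lemma bracket_jacobi:
  "poly_subst (bracket_at br mult_lambda p) mult_mu (br q r)
    = poly_subst (\<lambda>v. bracket_at br (mult_lambda + mult_mu) v r) mult_lambda (br p q)
    + poly_subst (bracket_at br mult_mu q) mult_lambda (br p r)"
proof (intro poly_eqI_ev[of "poly_scale sQ"] poly_eqI_ev[of sQ] poly_eqI_ev[of s])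
  fix l m x
  let ?g = "\<lambda>R. ev sQ m (ev (poly_scale sQ) l R)"
  have mult: "mult_lambda (R + R') = mult_lambda R + mult_lambda R'" "mult_lambda 0 = 0"
    "mult_mu (R + R') = mult_mu R + mult_mu R'" "mult_mu 0 = 0"
    "?g (mult_lambda R) = sQ l (?g R)" "?g (mult_mu R) = sQ m (?g R)" for R R' :: "'a poly poly poly"
    by (simp_all add: mult_lambda_def mult_mu_def map_poly_add ev_linear_simps
        ev_map_poly[OF linear_pCons_0])
  interpret Q: vector_space sQ by simp
  have at: "?g (bracket_at br mult_lambda u v) = ev sQ l (br u v)"
    "?g (bracket_at br mult_mu u v) = ev sQ m (br u v)"
    "?g (bracket_at br (mult_lambda + mult_mu) u v) = ev sQ (l + m) (br u v)" for u v
    by (rule eval_bracket_at; simp add: mult ev_linear_simps Q.scale_left_distrib)+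
  have at_0: "bracket_at br X 0 v = 0" "bracket_at br X u 0 = 0" for X u v
    using linear_at_0[OF linear_bracket(1)] linear_at_0[OF linear_bracket(2)]
    by (simp_all add: bracket_at_def poly_subst_0)
  have br_ev: "Vector_Spaces.linear sQ sQ (\<lambda>u. ev sQ c (br u v))"
    "Vector_Spaces.linear sQ sQ (\<lambda>v. ev sQ c (br u v))" for u v c
    by (rule linear_comp[OF linear_bracket(1) linear_ev] linear_comp[OF linear_bracket(2) linear_ev]; simp)+
  have 1: "?g (poly_subst (bracket_at br mult_lambda p) mult_mu (br q r))
      = ev sQ l (br p (ev sQ m (br q r))) \<and> True"
    by (rule eval_poly_subst[where g = ?g and I = "\<lambda>_. True" and s'' = sQ
          and h = "\<lambda>v. ev sQ l (br p v)"])
      (simp_all add: mult at at_0 br_ev ev_linear_simps)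
  have 2: "?g (poly_subst (\<lambda>v. bracket_at br (mult_lambda + mult_mu) v r) mult_lambda (br p q))
      = ev sQ (l + m) (br (ev sQ l (br p q)) r) \<and> True"
    by (rule eval_poly_subst[where g = ?g and I = "\<lambda>_. True" and s'' = sQ
          and h = "\<lambda>v. ev sQ (l + m) (br v r)"])
      (simp_all add: mult at at_0 br_ev ev_linear_simps)
  have 3: "?g (poly_subst (bracket_at br mult_mu q) mult_lambda (br p r))
      = ev sQ m (br q (ev sQ l (br p r))) \<and> True"
    by (rule eval_poly_subst[where g = ?g and I = "\<lambda>_. True" and s'' = sQ
          and h = "\<lambda>v. ev sQ m (br q v)"])
      (simp_all add: mult at at_0 br_ev ev_linear_simps)
  from 1 2 3 show "ev s x (?g (poly_subst (bracket_at br mult_lambda p) mult_mu (br q r)))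
    = ev s x (?g (poly_subst (\<lambda>v. bracket_at br (mult_lambda + mult_mu) v r) mult_lambda (br p q)
      + poly_subst (bracket_at br mult_mu q) mult_lambda (br p r)))"
    using lambda_product_jacobi[of x l "ev s (- l) p" m "ev s (- m) q" "ev s (m + (l + x)) r"]
    by (simp add: ev_linear_simps ev_bracket add_ac)
qed simp_all

lemma leibniz_conformal_algebra_bracket: "leibniz_conformal_algebra sQ (pCons 0) br"
proof -
  have "leibniz_conformal_algebra_axioms sQ (pCons 0) br"
    by (rule leibniz_conformal_algebra_axioms.intro)
      (simp_all only: linear_pCons_0[OF vs] linear_bracket dialgebra_bracket_sesquilinear bracket_jacobi)
  then show ?thesis by (simp add: leibniz_conformal_algebra_def)
qed

end

section \<open>Maps induced by a pair of coproducts\<close>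

text \<open>Eigenvectors of the transpose of \<open>D\<close> turn \<open>D\<close> into a scalar, because tensors, unlike arbitrary
  functions of two functionals, are linear in each argument.\<close>

lemma tensor_map_eigen:
  assumes s: "vector_space s" and T: "T \<in> tensor_space s"
    and lin: "Vector_Spaces.linear s (*) \<Phi>" "Vector_Spaces.linear s (*) \<Psi>"
    and eigen: "\<And>q. \<Phi> (D q) = x * \<Phi> q" "\<And>q. \<Psi> (D q) = y * \<Psi> q"
  shows "tensor_map s D id T \<Phi> \<Psi> = x * T \<Phi> \<Psi>"
    and "tensor_map s id D T \<Phi> \<Psi> = y * T \<Phi> \<Psi>"
    and "tensor_D s D T \<Phi> \<Psi> = (x + y) * T \<Phi> \<Psi>"
proof -
  show *: "tensor_map s D id T \<Phi> \<Psi> = x * T \<Phi> \<Psi>" "tensor_map s id D T \<Phi> \<Psi> = y * T \<Phi> \<Psi>"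
    using from_vector_simps(4)[OF from_vector_tensor(1)[OF s T] s lin(1)]
      from_vector_simps(4)[OF from_vector_tensor(2)[OF s T] s lin(2)]
    by (simp_all add: tensor_map_def lin comp_def eigen)
  show "tensor_D s D T \<Phi> \<Psi> = (x + y) * T \<Phi> \<Psi>"
    by (simp add: tensor_D_def * distrib_right)
qed

lemma restrict_to_A:
  assumes s: "vector_space s" and f: "D_hom_to_square (poly_scale s) (pCons 0) f"
    and f_A: "\<And>a. f [:a:] \<in> square_incl s ` tensor_space s"
  shows "restrict_to_A s f a \<in> tensor_space s"
    and "square_incl s (restrict_to_A s f a) = f [:a:]"
    and "Vector_Spaces.linear s tensor_scale (restrict_to_A s f)"
proof -
  show space: "restrict_to_A s f a \<in> tensor_space s" for a
    unfolding restrict_to_A_def by (rule inv_into_into[OF f_A])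
  show incl: "square_incl s (restrict_to_A s f a) = f [:a:]" for a
    unfolding restrict_to_A_def by (rule f_inv_into_f[OF f_A])
  have f_lin: "Vector_Spaces.linear (poly_scale s) tensor_scale f"
    using f by (simp add: D_hom_to_square_def)
  have incl_lin: "Vector_Spaces.linear tensor_scale tensor_scale (square_incl s)"
    unfolding square_incl_def by (rule linear_tensor_map)
  have "restrict_to_A s f (a + b) = restrict_to_A s f a + restrict_to_A s f b" for a b
    by (rule inj_onD[OF inj_on_square_incl[OF s]])
      (use linear_add[OF f_lin, of "[:a:]" "[:b:]"] in
        \<open>auto simp: incl linear_add[OF incl_lin] space simp del: plus_fun_apply\<close>)
  moreover have "restrict_to_A s f (s c a) = tensor_scale c (restrict_to_A s f a)" for c a
    by (rule inj_onD[OF inj_on_square_incl[OF s]])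
      (use linear_scale[OF f_lin, of c "[:a:]"] s in \<open>auto simp: incl linear_scale[OF incl_lin] space\<close>)
  ultimately show "Vector_Spaces.linear s tensor_scale (restrict_to_A s f)"
    using s by (simp add: Vector_Spaces.linear_iff)
qed

lemma square_incl_apply:
  assumes "vector_space s" "Vector_Spaces.linear s (*) f" "Vector_Spaces.linear s (*) g"
  shows "square_incl s T (\<lambda>p. f (ev s x p)) (\<lambda>p. g (ev s y p)) = T f g"
  using assms by (simp add: square_incl_def tensor_map_def comp_def ev_const)

locale lifted_coproducts = novikov_dialgebra_char_0 s ld rd
  for s :: "'k::field_char_0 \<Rightarrow> 'a::ab_group_add \<Rightarrow> 'a"
    and ld :: "'a \<Rightarrow> 'a \<Rightarrow> 'a" (infixl \<open>\<stileturn>\<close> 70)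
    and rd :: "'a \<Rightarrow> 'a \<Rightarrow> 'a" (infixl \<open>\<turnstile>\<close> 70) +
  fixes \<delta> \<Delta> \<alpha> :: "'a poly \<Rightarrow> ('k, 'a poly) tensor2"
  assumes \<delta>_hom: "D_hom_to_square (poly_scale s) (pCons 0) \<delta>"
    and \<Delta>_hom: "D_hom_to_square (poly_scale s) (pCons 0) \<Delta>"
    and \<delta>_A: "\<delta> [:a:] \<in> square_incl s ` tensor_space s"
    and \<Delta>_A: "\<Delta> [:a:] \<in> square_incl s ` tensor_space s"
    and \<alpha>_D_hom: "D_hom_to_square (poly_scale s) (pCons 0) \<alpha>"
    and \<alpha>_A: "\<alpha> [:a:] = tensor_map (poly_scale s) (pCons 0) id (\<Delta> [:a:])
           - flip (tensor_map (poly_scale s) (pCons 0) id (\<delta> [:a:]))"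
begin

abbreviation \<delta>\<^sub>A where "\<delta>\<^sub>A \<equiv> restrict_to_A s \<delta>"
abbreviation \<Delta>\<^sub>A where "\<Delta>\<^sub>A \<equiv> restrict_to_A s \<Delta>"
abbreviation functional :: "('a \<Rightarrow> 'k) \<Rightarrow> bool" where "functional \<equiv> Vector_Spaces.linear s (*)"
abbreviation eval_at :: "'k \<Rightarrow> ('a \<Rightarrow> 'k) \<Rightarrow> 'a poly \<Rightarrow> 'k" where "eval_at x f \<equiv> (\<lambda>p. f (ev s x p))"

lemmas restricted_space [simp] = restrict_to_A(1)[OF vs \<delta>_hom \<delta>_A] restrict_to_A(1)[OF vs \<Delta>_hom \<Delta>_A]
lemmas square_incl_restricted = restrict_to_A(2)[OF vs \<delta>_hom \<delta>_A] restrict_to_A(2)[OF vs \<Delta>_hom \<Delta>_A]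
lemmas linear_restricted = restrict_to_A(3)[OF vs \<delta>_hom \<delta>_A] restrict_to_A(3)[OF vs \<Delta>_hom \<Delta>_A]

lemma \<alpha>_space [simp]: "\<alpha> p \<in> tensor_space sQ"
  and linear_\<alpha>: "Vector_Spaces.linear sQ tensor_scale \<alpha>"
  and \<alpha>_pCons_0: "\<alpha> (pCons 0 p) = tensor_D sQ (pCons 0) (\<alpha> p)"
  using \<alpha>_D_hom by (simp_all add: D_hom_to_square_def)

lemma at_pCons_0: "functional f \<Longrightarrow> eval_at x f (pCons 0 p) = x * eval_at x f p"
  by (simp add: ev_pCons_0 linear_scale)

lemma at_tensor_map:
  assumes "T \<in> tensor_space sQ" "functional f" "functional g"
  shows "tensor_map sQ (pCons 0) id T (eval_at x f) (eval_at y g) = x * T (eval_at x f) (eval_at y g)"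
    and "tensor_D sQ (pCons 0) T (eval_at x f) (eval_at y g) = (x + y) * T (eval_at x f) (eval_at y g)"
  using assms by (simp_all add: tensor_map_eigen[where x = x and y = y] at_pCons_0)

text \<open>On \<open>A\<close> this is the definition of \<open>\<alpha>\<close>: there the two \<open>\<partial>\<close>'s become \<open>x\<close> and \<open>y\<close>, and \<open>\<tau>\<close> exchanges
  the functionals.  On multiples of \<open>\<partial>\<^sup>n\<close> a factor \<open>(x + y)\<^sup>n\<close> appears, because \<open>\<alpha>\<close> commutes with \<open>\<partial>\<close>.\<close>

lemma \<alpha>_at:
  assumes f: "functional f" and g: "functional g"
  shows "\<alpha> p (eval_at x f) (eval_at y g) = x * \<Delta>\<^sub>A (ev s (x + y) p) f g - y * \<delta>\<^sub>A (ev s (x + y) p) g f"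
proof (induction p)
  case 0
  then show ?case
    by (simp add: linear_at_0[OF linear_\<alpha>] ev_0 linear_at_0[OF linear_restricted(1)]
        linear_at_0[OF linear_restricted(2)])
next
  case (pCons a p)
  have "\<delta> [:a:] \<in> tensor_space sQ" "\<Delta> [:a:] \<in> tensor_space sQ"
    using \<delta>_hom \<Delta>_hom by (simp_all add: D_hom_to_square_def)
  then have 1: "\<alpha> [:a:] (eval_at x f) (eval_at y g) = x * \<Delta>\<^sub>A a f g - y * \<delta>\<^sub>A a g f"
    using f g by (simp add: \<alpha>_A flip_def at_tensor_map square_incl_restricted[symmetric]
        square_incl_apply)
  have 2: "\<alpha> (pCons a p) = \<alpha> [:a:] + tensor_D sQ (pCons 0) (\<alpha> p)"
    using linear_add[OF linear_\<alpha>, of "[:a:]" "pCons 0 p"] by (simp add: \<alpha>_pCons_0)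
  show ?case
    by (simp add: 1 2 pCons.IH f g at_tensor_map ev_pCons linear_add[OF linear_restricted(1)] tensor_scale_def
        linear_add[OF linear_restricted(2)] linear_scale[OF linear_restricted(1)]
        linear_scale[OF linear_restricted(2)] algebra_simps)
qed

lemma linear_restricted_apply [simp]: "functional (\<lambda>u. \<delta>\<^sub>A u f g)" "functional (\<lambda>u. \<Delta>\<^sub>A u f g)"
  by (rule linear_comp[OF linear_restricted(1) linear_tensor_apply]
      linear_comp[OF linear_restricted(2) linear_tensor_apply])+

lemmas restricted_off_functionals [simp] =
  from_vector_simps(5,6)[OF from_vector_tensor(1)[OF vs restricted_space(1)] vs]
  from_vector_simps(5,6)[OF from_vector_tensor(2)[OF vs restricted_space(1)] vs]
  from_vector_simps(5,6)[OF from_vector_tensor(1)[OF vs restricted_space(2)] vs]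
  from_vector_simps(5,6)[OF from_vector_tensor(2)[OF vs restricted_space(2)] vs]

lemmas restricted_bilinear =
  from_vector_simps(1,2,3,4)[OF from_vector_tensor(1)[OF vs restricted_space(1)] vs]
  from_vector_simps(1,2,3,4)[OF from_vector_tensor(2)[OF vs restricted_space(1)] vs]
  from_vector_simps(1,2,3,4)[OF from_vector_tensor(1)[OF vs restricted_space(2)] vs]
  from_vector_simps(1,2,3,4)[OF from_vector_tensor(2)[OF vs restricted_space(2)] vs]

section \<open>The coalgebra axiom\<close>

text \<open>The differences between the two sides of the axioms of a Novikov co-dialgebra, in the order in
  which the axioms are listed; differences are convenient because linear combinations of the axioms
  are needed.\<close>

definition codefect1 where "codefect1 a = cop_left \<delta>\<^sub>A (\<delta>\<^sub>A a) - flip23 (cop_left \<delta>\<^sub>A (\<delta>\<^sub>A a))"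
definition codefect2 where "codefect2 a = cop_left \<Delta>\<^sub>A (\<delta>\<^sub>A a) - flip23 (cop_left \<Delta>\<^sub>A (\<Delta>\<^sub>A a))"
definition codefect3 where
  "codefect3 a = flip23 (cop_left \<Delta>\<^sub>A (\<Delta>\<^sub>A a)) - flip23 (cop_left \<delta>\<^sub>A (\<Delta>\<^sub>A a))"
definition codefect4 where "codefect4 a = cop_right \<delta>\<^sub>A (\<delta>\<^sub>A a) - cop_right \<Delta>\<^sub>A (\<delta>\<^sub>A a)"
definition codefect5 where "codefect5 a = (cop_left \<delta>\<^sub>A (\<delta>\<^sub>A a) - cop_right \<delta>\<^sub>A (\<delta>\<^sub>A a))
  - flip12 (cop_left \<Delta>\<^sub>A (\<delta>\<^sub>A a) - cop_right \<delta>\<^sub>A (\<Delta>\<^sub>A a))"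
definition codefect6 where "codefect6 a = (cop_left \<Delta>\<^sub>A (\<Delta>\<^sub>A a) - cop_right \<Delta>\<^sub>A (\<Delta>\<^sub>A a))
  - flip12 (cop_left \<Delta>\<^sub>A (\<Delta>\<^sub>A a) - cop_right \<Delta>\<^sub>A (\<Delta>\<^sub>A a))"

lemmas codefect_defs = codefect1_def codefect2_def codefect3_def codefect4_def codefect5_def
  codefect6_def

lemma novikov_codialgebra_iff:
  "novikov_codialgebra s \<delta>\<^sub>A \<Delta>\<^sub>A \<longleftrightarrow> (\<forall>a. codefect1 a = 0 \<and> codefect2 a = 0 \<and> codefect3 a = 0
    \<and> codefect4 a = 0 \<and> codefect5 a = 0 \<and> codefect6 a = 0)"
  by (auto simp: novikov_codialgebra_def novikov_codialgebra_axioms_def vs linear_restricted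
      codefect_defs right_minus_eq)

text \<open>Forms coming from tensors vanish as soon as an argument is not linear, so linear functionals
  suffice for testing.\<close>

lemma codefect_eq_0I:
  assumes "T \<in> {codefect1 a, codefect2 a, codefect3 a, codefect4 a, codefect5 a, codefect6 a}"
    and 0: "\<And>f g h. functional f \<Longrightarrow> functional g \<Longrightarrow> functional h \<Longrightarrow> T f g h = 0"
  shows "T = 0"
proof -
  have "T f g h = 0" if "\<not> (functional f \<and> functional g \<and> functional h)" for f g h
    using assms(1) that
    by (auto simp: codefect_defs cop_left_def cop_right_def flip12_def flip23_def)
  with 0 have "T f g h = 0" for f g h by blast
  then show ?thesis by (simp add: fun_eq_iff)
qed

text \<open>For \<open>f\<close>, \<open>g\<close>, \<open>h\<close> fixed, \<open>v \<mapsto> \<alpha>(v)(f\<^sub>x, g\<^sub>y)\<close> is again a test functional, namely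
  \<open>\<omega>\<^sub>x\<^sub>+\<^sub>y\<close> with \<open>\<omega>(u) = x \<Delta>(u)(f, g) - y \<delta>(u)(g, f)\<close>.  Hence the formula for \<open>\<alpha>\<close> at test
  functionals can be applied twice, and all terms involve the same element \<open>a\<close> of \<open>A\<close>.\<close>

lemma cojacobi_at:
  assumes f: "functional f" and g: "functional g" and h: "functional h"
    and a: "a = ev s (x + y + z) p"
  shows "(cop_right \<alpha> (\<alpha> p) - (cop_left \<alpha> (\<alpha> p) + flip12 (cop_right \<alpha> (\<alpha> p))))
      (eval_at x f) (eval_at y g) (eval_at z h)
    = x\<^sup>2 * codefect2 a f h g - y\<^sup>2 * (codefect2 a g h f + codefect3 a g h f) + z\<^sup>2 * codefect1 a h g f
      - x * y * (codefect6 a f g h + codefect3 a g h f)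
      - x * z * (codefect5 a h f g + codefect4 a h f g) + y * z * codefect5 a h g f"
proof -
  define \<omega> where "\<omega> x y f g = (\<lambda>u. x * \<Delta>\<^sub>A u f g - y * \<delta>\<^sub>A u g f)" for x y f g
  have [simp]: "functional (\<omega> x y f g)" for x y f g
    by (simp add: \<omega>_def)
  have \<alpha>_\<omega>: "(\<lambda>v. \<alpha> v (eval_at x f) (eval_at y g)) = eval_at (x + y) (\<omega> x y f g)"
    if "functional f" "functional g" for x y f g
    by (simp add: \<alpha>_at that \<omega>_def)
  have right: "cop_right \<alpha> (\<alpha> p) (eval_at x f) (eval_at y g) (eval_at z h)
      = x * \<Delta>\<^sub>A a f (\<omega> y z g h) - (y + z) * \<delta>\<^sub>A a (\<omega> y z g h) f"
    if "functional f" "functional g" "functional h" "a = ev s (x + y + z) p" for f g h x y z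
    unfolding cop_right_def \<alpha>_\<omega>[OF that(2,3)] by (simp add: \<alpha>_at that add_ac)
  have left: "cop_left \<alpha> (\<alpha> p) (eval_at x f) (eval_at y g) (eval_at z h)
      = (x + y) * \<Delta>\<^sub>A a (\<omega> x y f g) h - z * \<delta>\<^sub>A a h (\<omega> x y f g)"
    unfolding cop_left_def \<alpha>_\<omega>[OF f g] by (simp add: \<alpha>_at h a)
  have a': "a = ev s (y + x + z) p"
    by (simp add: a add_ac)
  show ?thesis
    unfolding fun_diff_def plus_fun_apply flip12_def right[OF f g h a] right[OF g f h a'] left
    by (simp add: codefect_defs cop_left_def cop_right_def flip12_def flip23_def \<omega>_def f g h
        restricted_bilinear) (simp add: algebra_simps power2_eq_square)
qed

text \<open>The points \<open>(1,0,0)\<close>, \<open>(0,1,0)\<close>, \<open>(0,0,1)\<close>, \<open>(1,1,0)\<close>, \<open>(0,1,1)\<close>, \<open>(1,0,1)\<close> isolate the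
  six coefficients in the order in which they can be solved for.\<close>

lemma coalgebra_iff:
  "leibniz_conformal_coalgebra sQ (pCons 0) \<alpha> \<longleftrightarrow> novikov_codialgebra s \<delta>\<^sub>A \<Delta>\<^sub>A"
proof
  assume "leibniz_conformal_coalgebra sQ (pCons 0) \<alpha>"
  then interpret C: leibniz_conformal_coalgebra sQ "pCons 0" \<alpha> .
  have eq: "x\<^sup>2 * codefect2 a f h g - y\<^sup>2 * (codefect2 a g h f + codefect3 a g h f)
      + z\<^sup>2 * codefect1 a h g f - x * y * (codefect6 a f g h + codefect3 a g h f)
      - x * z * (codefect5 a h f g + codefect4 a h f g) + y * z * codefect5 a h g f = 0"
    if "functional f" "functional g" "functional h" for a f g h x y z
    using cojacobi_at[OF that, of a x y z "[:a:]"] C.cojacobi[of "[:a:]"] by (simp add: ev_const)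
  have 2: "codefect2 a f g h = 0" if "functional f" "functional g" "functional h" for a f g h
    using eq[OF that(1,3,2), of 1 a 0 0] by simp
  have 3: "codefect3 a f g h = 0" if "functional f" "functional g" "functional h" for a f g h
    using eq[OF that(3,1,2), of 0 a 1 0] 2[OF that] by simp
  have 1: "codefect1 a f g h = 0" if "functional f" "functional g" "functional h" for a f g h
    using eq[OF that(3,2,1), of 0 a 0 1] by simp
  have 6: "codefect6 a f g h = 0" if "functional f" "functional g" "functional h" for a f g h
    using eq[OF that, of 1 a 1 0] by (simp add: 2 3 that)
  have 5: "codefect5 a f g h = 0" if "functional f" "functional g" "functional h" for a f g h
    using eq[OF that(3,2,1), of 0 a 1 1] by (simp add: 1 2 3 that)
  have 4: "codefect4 a f g h = 0" if "functional f" "functional g" "functional h" for a f g h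
    using eq[OF that(2,3,1), of 1 a 0 1] by (simp add: 1 2 5 that)
  show "novikov_codialgebra s \<delta>\<^sub>A \<Delta>\<^sub>A"
    unfolding novikov_codialgebra_iff
    by (intro allI conjI; rule codefect_eq_0I) (use 1 2 3 4 5 6 in auto)
next
  assume "novikov_codialgebra s \<delta>\<^sub>A \<Delta>\<^sub>A"
  then have 0: "codefect1 a = 0" "codefect2 a = 0" "codefect3 a = 0" "codefect4 a = 0"
    "codefect5 a = 0" "codefect6 a = 0" for a
    by (simp_all add: novikov_codialgebra_iff)
  have "cop_right \<alpha> (\<alpha> p) - (cop_left \<alpha> (\<alpha> p) + flip12 (cop_right \<alpha> (\<alpha> p))) = 0" for p
  proof (rule trilinear_form_poly_eq_0[OF vs])
    show "trilinear_form sQ (cop_right \<alpha> (\<alpha> p) - (cop_left \<alpha> (\<alpha> p) + flip12 (cop_right \<alpha> (\<alpha> p))))"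
      by (intro trilinear_form_closed trilinear_form_cop linear_\<alpha>) simp_all
    show "(cop_right \<alpha> (\<alpha> p) - (cop_left \<alpha> (\<alpha> p) + flip12 (cop_right \<alpha> (\<alpha> p))))
        (eval_at x f) (eval_at y g) (eval_at z h) = 0"
      if "functional f" "functional g" "functional h" for f g h x y z
      unfolding cojacobi_at[OF that refl] 0 by simp
  qed
  then have "leibniz_conformal_coalgebra_axioms sQ (pCons 0) \<alpha>"
    by (simp only: leibniz_conformal_coalgebra_axioms_def linear_pCons_0[OF vs] \<alpha>_D_hom
        right_minus_eq simp_thms)
  then show "leibniz_conformal_coalgebra sQ (pCons 0) \<alpha>"
    by (simp add: leibniz_conformal_coalgebra_def)
qed

section \<open>Substitutions evaluated\<close>

lemma tensor_map_D_space:
  assumes "T \<in> tensor_space sQ"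
  shows "tensor_map sQ (pCons 0) id T \<in> tensor_space sQ"
    and "tensor_D sQ (pCons 0) T \<in> tensor_space sQ"
proof -
  have id: "Vector_Spaces.linear sQ sQ id"
    by (rule vector_space.linear_id) simp
  show "tensor_map sQ (pCons 0) id T \<in> tensor_space sQ"
    "tensor_D sQ (pCons 0) T \<in> tensor_space sQ"
    unfolding tensor_D_def
    by (intro tensor_space_closed tensor_space_map[OF linear_pCons_0[OF vs] id assms]
        tensor_space_map[OF id linear_pCons_0[OF vs] assms])+
qed

lemma linear_tensor_D: "Vector_Spaces.linear tensor_scale tensor_scale (tensor_D sQ (pCons 0))"
proof -
  have "tensor_D sQ (pCons 0) = (\<lambda>T. tensor_map sQ (pCons 0) id T + tensor_map sQ id (pCons 0) T)"
    by (simp add: fun_eq_iff tensor_D_def)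
  then show ?thesis
    by (simp add: Vector_Spaces.linear_iff linear_add[OF linear_tensor_map]
        linear_scale[OF linear_tensor_map] del: plus_fun_apply)
       (simp add: tensor_scale_def fun_eq_iff algebra_simps)
qed

lemma substitutions_at:
  assumes P: "tensor_poly sQ P" and f: "functional f" and g: "functional g"
  shows "ev tensor_scale l (subst_minus_D1 sQ (pCons 0) P) (eval_at x f) (eval_at y g)
      = ev tensor_scale (l - x) P (eval_at x f) (eval_at y g)"
    and "ev tensor_scale l (subst_neg_D1 sQ (pCons 0) P) (eval_at x f) (eval_at y g)
      = ev tensor_scale (- l - x) P (eval_at x f) (eval_at y g)"
    and "ev tensor_scale l (subst_neg_D2 sQ (pCons 0) P) (eval_at x f) (eval_at y g)
      = ev tensor_scale (- l - (x + y)) P (eval_at x f) (eval_at y g)"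
    and "tensor_poly sQ (subst_minus_D1 sQ (pCons 0) P)"
    and "tensor_poly sQ (subst_neg_D1 sQ (pCons 0) P)"
    and "tensor_poly sQ (subst_neg_D2 sQ (pCons 0) P)"
proof -
  note D1 = linear_tensor_map tensor_map_D_space(1) at_tensor_map(1)[OF _ f g]
  note D2 = linear_tensor_D tensor_map_D_space(2) at_tensor_map(2)[OF _ f g]
  show "ev tensor_scale l (subst_minus_D1 sQ (pCons 0) P) (eval_at x f) (eval_at y g)
      = ev tensor_scale (l - x) P (eval_at x f) (eval_at y g)"
    and "tensor_poly sQ (subst_minus_D1 sQ (pCons 0) P)"
    unfolding subst_minus_D1_def
    by (rule ev_subst_tensor[where Y = "pCons 0" and c = "l" and l = l,
          OF refl _ D1 P]; auto simp: fun_eq_iff)+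
  show "ev tensor_scale l (subst_neg_D1 sQ (pCons 0) P) (eval_at x f) (eval_at y g)
      = ev tensor_scale (- l - x) P (eval_at x f) (eval_at y g)"
    and "tensor_poly sQ (subst_neg_D1 sQ (pCons 0) P)"
    unfolding subst_neg_D1_def
    by (rule ev_subst_tensor[where Y = "\<lambda>P. - pCons 0 P" and c = "- l" and l = l,
          OF refl _ D1 P]; auto simp: fun_eq_iff)+
  show "ev tensor_scale l (subst_neg_D2 sQ (pCons 0) P) (eval_at x f) (eval_at y g)
      = ev tensor_scale (- l - (x + y)) P (eval_at x f) (eval_at y g)"
    and "tensor_poly sQ (subst_neg_D2 sQ (pCons 0) P)"
    unfolding subst_neg_D2_def
    by (rule ev_subst_tensor[where Y = "\<lambda>P. - pCons 0 P" and c = "- l" and l = l,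
          OF refl _ D2 P]; auto simp: fun_eq_iff)+
qed

lemma linear_cL: "Vector_Spaces.linear sQ (poly_scale sQ) (cL br p)"
  using linear_bracket(2) by (simp add: cL_def[abs_def])

lemma tensor_poly_operators [simp]:
  assumes "T \<in> tensor_space sQ"
  shows "tensor_poly sQ (poly_tensor_left sQ (cR (pCons 0) br p) T)"
    and "tensor_poly sQ (poly_tensor_right sQ (cR (pCons 0) br p) T)"
    and "tensor_poly sQ (poly_tensor_left sQ (cL br p) T)"
    and "tensor_poly sQ (poly_tensor_right sQ (cL br p) T)"
  by (simp_all add: tensor_poly_left tensor_poly_right linear_cR linear_cL assms)

lemma linear_f_lambda_product [simp]:
  assumes "functional f"
  shows "functional (\<lambda>u. f (lambda_product x l u a))" "functional (\<lambda>u. f (lambda_product x l a u))"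
  using linear_comp[OF linear_lambda_product(1) assms] linear_comp[OF linear_lambda_product(2) assms]
  by auto

text \<open>The operators \<open>L\<close> and \<open>R\<close> transform a test functional into a test functional, at the point to
  which the bracket shifts \<open>\<partial>\<close>.\<close>

lemma operators_at:
  assumes T: "T \<in> tensor_space sQ" and f: "functional f" and g: "functional g"
  shows "ev tensor_scale l (poly_tensor_left sQ (cR (pCons 0) br p) T) (eval_at x f) (eval_at y g)
      = T (eval_at (l + x) (\<lambda>u. f (lambda_product x (- l - x) u (ev s (- l) p)))) (eval_at y g)"
    and "ev tensor_scale l (poly_tensor_right sQ (cR (pCons 0) br p) T) (eval_at x f) (eval_at y g)
      = T (eval_at x f) (eval_at (l + y) (\<lambda>u. g (lambda_product y (- l - y) u (ev s (- l) p))))"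
    and "ev tensor_scale l (poly_tensor_left sQ (cL br p) T) (eval_at x f) (eval_at y g)
      = T (eval_at (l + x) (\<lambda>u. f (lambda_product x l (ev s (- l) p) u))) (eval_at y g)"
    and "ev tensor_scale l (poly_tensor_right sQ (cL br p) T) (eval_at x f) (eval_at y g)
      = T (eval_at x f) (eval_at (l + y) (\<lambda>u. g (lambda_product y l (ev s (- l) p) u)))"
  by (simp_all add: ev_poly_tensor_left ev_poly_tensor_right linear_cR linear_cL T f g ev_cR)
    (simp_all add: cL_def ev_bracket)

section \<open>The compatibility conditions\<close>

text \<open>Taking differences of sides is needed because the compatibility conditions yield some of the nine
  conditions only in linear combination with others.\<close>

definition defect1 where "defect1 a b = tensor_map s (oL ld a) id (\<Delta>\<^sub>A b)
  + tensor_map s id (oL ld b + oR rd b) (\<delta>\<^sub>A a)"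
definition defect2 where "defect2 a b = tensor_map s id (oL ld b) (\<delta>\<^sub>A a)
  - tensor_map s (oL ld a) id (flip (\<delta>\<^sub>A b))"
definition defect3 where "defect3 a b = tensor_map s id (oL ld a + oR rd a) (\<delta>\<^sub>A b + flip (\<Delta>\<^sub>A b))
  - tensor_map s (oR rd b) id (\<Delta>\<^sub>A a)"
definition defect4 where "defect4 a b = \<delta>\<^sub>A (a \<stileturn> b) - (tensor_map s (oR ld b) id (\<delta>\<^sub>A a)
  + tensor_map s id (oL (star ld rd) a) ((\<delta>\<^sub>A b - \<Delta>\<^sub>A b) - flip (\<delta>\<^sub>A b - \<Delta>\<^sub>A b)))"
definition defect5 where "defect5 a b = \<delta>\<^sub>A (a \<turnstile> b) - (tensor_map s (oR rd b) id (\<delta>\<^sub>A a - \<Delta>\<^sub>A a)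
  + tensor_map s id (oL rd a + oR ld a) (\<delta>\<^sub>A b + flip (\<Delta>\<^sub>A b)))"
definition defect6 where "defect6 a b = \<Delta>\<^sub>A (a \<stileturn> b)
  - (tensor_map s id (oL ld a + oR rd a) ((\<Delta>\<^sub>A b - \<delta>\<^sub>A b) - flip (\<Delta>\<^sub>A b - \<delta>\<^sub>A b))
  + tensor_map s (oR ld b) id (\<Delta>\<^sub>A a))"
definition defect7 where "defect7 a b = \<Delta>\<^sub>A (a \<turnstile> b)
  - (tensor_map s (oR rd b - oR ld b) id (\<delta>\<^sub>A a - \<Delta>\<^sub>A a)
  + tensor_map s id (oL rd a + oR ld a) (flip (\<delta>\<^sub>A b) + \<Delta>\<^sub>A b))"
definition defect8 where "defect8 a b = tensor_map s (oL ld b + oR rd b) id (\<delta>\<^sub>A a - \<Delta>\<^sub>A a)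
  + tensor_map s id (oL (star ld rd) b) (flip (\<delta>\<^sub>A a - \<Delta>\<^sub>A a))
  - tensor_map s (oL rd a + oR ld a) id (\<delta>\<^sub>A b)
  + tensor_map s id (oL rd a + oR ld a) (flip (\<Delta>\<^sub>A b))"
definition defect9 where "defect9 a b
  = tensor_map s id (oR rd a) ((\<delta>\<^sub>A b - \<Delta>\<^sub>A b) - flip (\<delta>\<^sub>A b - \<Delta>\<^sub>A b))
  - tensor_map s (oR ld b) id (\<Delta>\<^sub>A a + flip (\<delta>\<^sub>A a))
  - (- tensor_map s id (oR ld b) (\<Delta>\<^sub>A a + flip (\<delta>\<^sub>A a))
  + tensor_map s (oR rd a - oR ld a) id ((\<Delta>\<^sub>A b - \<delta>\<^sub>A b) - flip (\<Delta>\<^sub>A b - \<delta>\<^sub>A b)))"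

lemmas defect_defs = defect1_def defect2_def defect3_def defect4_def defect5_def defect6_def
  defect7_def defect8_def defect9_def

lemma novikov_bidialgebra_iff:
  "novikov_bidialgebra s ld rd \<delta>\<^sub>A \<Delta>\<^sub>A \<longleftrightarrow> novikov_codialgebra s \<delta>\<^sub>A \<Delta>\<^sub>A
    \<and> (\<forall>a b. defect1 a b = 0 \<and> defect2 a b = 0 \<and> defect3 a b = 0)
    \<and> (\<forall>a b. defect4 a b = 0 \<and> defect5 a b = 0 \<and> defect6 a b = 0
      \<and> defect7 a b = 0 \<and> defect8 a b = 0 \<and> defect9 a b = 0)"
  unfolding novikov_bidialgebra_def novikov_bidialgebra_axioms_def defect_defs right_minus_eq
    eq_neg_iff_add_eq_0
  using novikov_dialgebra_axioms by blast

lemma defect_eq_0I: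
  assumes T: "T \<in> {defect1 a b, defect2 a b, defect3 a b, defect4 a b, defect5 a b, defect6 a b,
      defect7 a b, defect8 a b, defect9 a b}"
    and 0: "\<And>f g. functional f \<Longrightarrow> functional g \<Longrightarrow> T f g = 0"
  shows "T = 0"
proof -
  have "T f g = 0" if "\<not> (functional f \<and> functional g)" for f g
    using T that by (auto simp: defect_defs tensor_map_def flip_def)
  with 0 have "T f g = 0" for f g by blast
  then show ?thesis by (simp add: fun_eq_iff)
qed

lemma linear_f_product [simp]:
  assumes "functional f"
  shows "functional (\<lambda>u. f (a \<stileturn> u))" "functional (\<lambda>u. f (u \<stileturn> a))"
    "functional (\<lambda>u. f (a \<turnstile> u))" "functional (\<lambda>u. f (u \<turnstile> a))"
  by (rule linear_comp[OF ld_linear_right assms] linear_comp[OF ld_linear_left assms]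
      linear_comp[OF rd_linear_right assms] linear_comp[OF rd_linear_left assms])+

lemma functional_simps:
  assumes "functional f"
  shows "f (u + v) = f u + f v" "f (u - v) = f u - f v" "f (- u) = - f u" "f (s c u) = c * f u"
  by (simp_all add: linear_add[OF assms] linear_minus[OF assms] linear_neg[OF assms]
      linear_scale[OF assms])

lemma restricted_combination:
  "\<delta>\<^sub>A (u + v) f g = \<delta>\<^sub>A u f g + \<delta>\<^sub>A v f g" "\<delta>\<^sub>A (s c u) f g = c * \<delta>\<^sub>A u f g"
  "\<Delta>\<^sub>A (u + v) f g = \<Delta>\<^sub>A u f g + \<Delta>\<^sub>A v f g" "\<Delta>\<^sub>A (s c u) f g = c * \<Delta>\<^sub>A u f g"
  by (simp_all add: linear_add[OF linear_restricted(1)] linear_add[OF linear_restricted(2)]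
      linear_scale[OF linear_restricted(1)] linear_scale[OF linear_restricted(2)] tensor_scale_def)

lemmas defect_apply_simps = defect_defs tensor_map_def flip_def oL_def oR_def star_def comp_def
  lambda_product_def functional_simps restricted_bilinear restricted_combination

text \<open>Both sides evaluate to expressions in the same two elements \<open>a\<close> and \<open>b\<close>.  The coefficients of
  \<open>l x\<close> and \<open>l y\<close> are two instances of \<open>binov1\<close>, and that of \<open>x y\<close> is \<open>binov2\<close>.  In the coefficient of
  \<open>l\<^sup>2\<close> only the sum \<open>L\<^sub>\<stileturn> + R\<^sub>\<turnstile>\<close> occurs, but \<open>binov3\<close> contains \<open>R\<^sub>\<turnstile>\<close> alone; the two differ by an
  instance of \<open>binov1\<close>.\<close>

lemma compat1_at:
  assumes f: "functional f" and g: "functional g"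
    and a: "a = ev s (x - l) p" and b: "b = ev s (l + y) q"
  shows "ev tensor_scale l (subst_minus_D1 sQ (pCons 0)
        (poly_tensor_left sQ (cR (pCons 0) br p) (\<alpha> q))) (eval_at x f) (eval_at y g)
      - ev tensor_scale l (map_poly flip (subst_neg_D1 sQ (pCons 0)
        (poly_tensor_left sQ (cR (pCons 0) br q) (\<alpha> p)))) (eval_at x f) (eval_at y g)
    = l * x * defect1 a b f g + l * (y + l) * defect1 b a g f + x * y * defect2 a b f g
      - l\<^sup>2 * defect3 a b g f"
proof -
  have "ev tensor_scale l (subst_minus_D1 sQ (pCons 0)
        (poly_tensor_left sQ (cR (pCons 0) br p) (\<alpha> q))) (eval_at x f) (eval_at y g)
      = \<alpha> q (eval_at l (\<lambda>u. f (lambda_product x (- l) u a))) (eval_at y g)"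
    by (simp add: substitutions_at operators_at f g a)
  also have "\<dots> = l * \<Delta>\<^sub>A b (\<lambda>u. f (lambda_product x (- l) u a)) g
      - y * \<delta>\<^sub>A b g (\<lambda>u. f (lambda_product x (- l) u a))"
    by (subst \<alpha>_at) (simp_all add: f g b)
  finally have 1: "ev tensor_scale l (subst_minus_D1 sQ (pCons 0)
        (poly_tensor_left sQ (cR (pCons 0) br p) (\<alpha> q))) (eval_at x f) (eval_at y g) = \<dots>" .
  have "ev tensor_scale l (map_poly flip (subst_neg_D1 sQ (pCons 0)
        (poly_tensor_left sQ (cR (pCons 0) br q) (\<alpha> p)))) (eval_at x f) (eval_at y g)
      = \<alpha> p (eval_at (- l) (\<lambda>u. g (lambda_product y l u b))) (eval_at x f)"
    by (simp add: ev_map_poly[OF linear_flip] flip_def substitutions_at operators_at f g b add.commute)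
  also have "\<dots> = - l * \<Delta>\<^sub>A a (\<lambda>u. g (lambda_product y l u b)) f
      - x * \<delta>\<^sub>A a f (\<lambda>u. g (lambda_product y l u b))"
    by (subst \<alpha>_at) (simp_all add: f g a)
  finally have 2: "ev tensor_scale l (map_poly flip (subst_neg_D1 sQ (pCons 0)
        (poly_tensor_left sQ (cR (pCons 0) br q) (\<alpha> p)))) (eval_at x f) (eval_at y g) = \<dots>" .
  show ?thesis
    unfolding 1 2
    by (simp add: defect_apply_simps f g) (simp add: algebra_simps power2_eq_square)
qed

lemma compat1_iff:
  "(\<forall>p q. subst_minus_D1 sQ (pCons 0) (poly_tensor_left sQ (cR (pCons 0) br p) (\<alpha> q))
      = map_poly flip (subst_neg_D1 sQ (pCons 0) (poly_tensor_left sQ (cR (pCons 0) br q) (\<alpha> p))))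
    \<longleftrightarrow> (\<forall>a b. defect1 a b = 0 \<and> defect2 a b = 0 \<and> defect3 a b = 0)"
  (is "(\<forall>p q. ?L p q = ?R p q) \<longleftrightarrow> ?defects")
proof
  assume "\<forall>p q. ?L p q = ?R p q"
  then have eq: "l * x * defect1 a b f g + l * (y + l) * defect1 b a g f + x * y * defect2 a b f g
      - l\<^sup>2 * defect3 a b g f = 0" if "functional f" "functional g" for a b f g x y l
    using compat1_at[OF that, where p = "[:a:]" and q = "[:b:]" and l = l and x = x and y = y and a = a
        and b = b] by (simp add: ev_const)
  have 2: "defect2 a b f g = 0" if "functional f" "functional g" for a b f g
    using eq[OF that, of 0 1 a b 1] by simp
  have 13: "defect1 b a g f = defect3 a b g f" if "functional f" "functional g" for a b f g
    using eq[OF that, of 1 0 a b 0] by simp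
  have 1: "defect1 a b f g = 0" if "functional f" "functional g" for a b f g
    using eq[OF that, of 1 1 a b 0] 13[OF that] by simp
  show ?defects
    by (intro allI conjI; rule defect_eq_0I) (use 1 2 13 in auto)
next
  assume 0: ?defects
  show "\<forall>p q. ?L p q = ?R p q"
  proof (intro allI poly_of_tensors_eqI[OF vs])
    fix p q
    note zero = linear_functional_0[OF vs]
    show "tensor_poly sQ (?L p q)"
      by (simp add: substitutions_at[OF _ zero zero])
    show "tensor_poly sQ (?R p q)"
      by (rule tensor_poly_map[where s = sQ]) (simp_all add: substitutions_at[OF _ zero zero])
    show "ev tensor_scale l (?L p q) (eval_at x f) (eval_at y g)
        = ev tensor_scale l (?R p q) (eval_at x f) (eval_at y g)"
      if "functional f" "functional g" for f g x y l
      using compat1_at[OF that refl refl, where l = l and p = p and q = q and x = x and y = y] 0 by simp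
  qed
qed

text \<open>Wherever \<open>\<alpha>(p)\<close> occurs it is evaluated at a pair of points with sum \<open>-l\<close>, and \<open>\<alpha>(q)\<close> at a pair with
  sum \<open>l + x + y\<close>, so that again only \<open>a\<close> and \<open>b\<close> matter.  The squares \<open>x\<^sup>2\<close>, \<open>y\<^sup>2\<close> and \<open>l\<^sup>2\<close> carry
  \<open>binov6\<close>, \<open>binov4\<close> and \<open>binov8\<close>; removing these together with a factor \<open>x + y + l\<close> leaves exactly
  \<open>binov9\<close>, \<open>binov7\<close> and \<open>binov5\<close> at the mixed monomials.\<close>

lemma compat2_at:
  assumes f: "functional f" and g: "functional g"
    and a: "a = ev s (- l) p" and b: "b = ev s (l + (x + y)) q"
  shows "ev tensor_scale l (map_poly \<alpha> (br p q)) (eval_at x f) (eval_at y g)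
    - ev tensor_scale l
       (subst_neg_D2 sQ (pCons 0) (poly_tensor_right sQ (cR (pCons 0) br q) (flip (\<alpha> p) + \<alpha> p))
       - subst_neg_D2 sQ (pCons 0) (poly_tensor_left sQ (cL br q) (flip (\<alpha> p) + \<alpha> p))
       - subst_neg_D2 sQ (pCons 0) (poly_tensor_left sQ (cR (pCons 0) br q) (flip (\<alpha> p) + \<alpha> p))
       + poly_tensor_right sQ (cL br p) (\<alpha> q)
       + poly_tensor_left sQ (cL br p) (\<alpha> q)) (eval_at x f) (eval_at y g)
    = (x + y + l) * (x * defect6 b a f g - y * defect4 b a g f - l * defect8 a b g f)
      - x * y * defect9 b a f g + x * l * defect7 a b f g - y * l * defect5 a b g f"
proof -
  have \<alpha>_p: "\<alpha> p (eval_at v h) (eval_at w k) = v * \<Delta>\<^sub>A a h k - w * \<delta>\<^sub>A a k h"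
    if "functional h" "functional k" "v + w = - l" for h k v w
    using \<alpha>_at[OF that(1,2), of p v w] that(3) a by simp
  have \<alpha>_q: "\<alpha> q (eval_at v h) (eval_at w k) = v * \<Delta>\<^sub>A b h k - w * \<delta>\<^sub>A b k h"
    if "functional h" "functional k" "v + w = l + (x + y)" for h k v w
    using \<alpha>_at[OF that(1,2), of q v w] that(3) b by simp
  \<comment> \<open>The test functionals into which \<open>R(q)\<close>, \<open>L(q)\<close>, \<open>R(q)\<close>, \<open>L(p)\<close>, \<open>L(p)\<close> transform \<open>g\<close> or \<open>f\<close>, in the
    order of the five terms on the right-hand side of the condition.\<close>
  define \<eta> where "\<eta> = (\<lambda>u. g (lambda_product y (l + x) u b))"
  define \<zeta> where "\<zeta> = (\<lambda>u. f (lambda_product x (- l - (x + y)) b u))"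
  define \<xi> where "\<xi> = (\<lambda>u. f (lambda_product x (l + y) u b))"
  define \<kappa> where "\<kappa> = (\<lambda>u. g (lambda_product y l a u))"
  define \<kappa>' where "\<kappa>' = (\<lambda>u. f (lambda_product x l a u))"
  have lin: "functional \<eta>" "functional \<zeta>" "functional \<xi>" "functional \<kappa>" "functional \<kappa>'"
    by (simp_all add: \<eta>_def \<zeta>_def \<xi>_def \<kappa>_def \<kappa>'_def f g)
  have arith: "- l - (x + y) + y = - l - x" "- (- l - (x + y)) - y = l + x"
    "- l - (x + y) + x = - l - y" "- (- l - (x + y)) - x = l + y" "- (- l - (x + y)) = l + (x + y)"
    by simp_all
  let ?T = "flip (\<alpha> p) + \<alpha> p"
  have T: "?T \<in> tensor_space sQ"
    by (intro tensor_space_closed tensor_space_flip) simp_all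
  have T_apply: "?T \<Phi> \<Psi> = \<alpha> p \<Psi> \<Phi> + \<alpha> p \<Phi> \<Psi>" for \<Phi> \<Psi>
    by (simp add: flip_def)
  have lhs: "ev tensor_scale l (map_poly \<alpha> (br p q)) (eval_at x f) (eval_at y g)
      = x * \<Delta>\<^sub>A (lambda_product (x + y) l a b) f g - y * \<delta>\<^sub>A (lambda_product (x + y) l a b) g f"
    by (simp add: ev_map_poly[OF linear_\<alpha>] \<alpha>_at f g ev_bracket a b)
  have 1: "ev tensor_scale l (subst_neg_D2 sQ (pCons 0)
        (poly_tensor_right sQ (cR (pCons 0) br q) ?T)) (eval_at x f) (eval_at y g)
      = (- l - x) * \<Delta>\<^sub>A a \<eta> f - x * \<delta>\<^sub>A a f \<eta> + (x * \<Delta>\<^sub>A a f \<eta> - (- l - x) * \<delta>\<^sub>A a \<eta> f)"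
    unfolding substitutions_at(3)[OF tensor_poly_operators(2)[OF T] f g] operators_at(2)[OF T f g]
      arith b[symmetric] T_apply
    by (simp add: \<alpha>_p[OF lin(1) f, unfolded \<eta>_def] \<alpha>_p[OF f lin(1), unfolded \<eta>_def] \<eta>_def)
  have 2: "ev tensor_scale l (subst_neg_D2 sQ (pCons 0)
        (poly_tensor_left sQ (cL br q) ?T)) (eval_at x f) (eval_at y g)
      = y * \<Delta>\<^sub>A a g \<zeta> - (- l - y) * \<delta>\<^sub>A a \<zeta> g + ((- l - y) * \<Delta>\<^sub>A a \<zeta> g - y * \<delta>\<^sub>A a g \<zeta>)"
    unfolding substitutions_at(3)[OF tensor_poly_operators(3)[OF T] f g] operators_at(3)[OF T f g]
      arith b[symmetric] T_apply
    by (simp add: \<alpha>_p[OF lin(2) g, unfolded \<zeta>_def] \<alpha>_p[OF g lin(2), unfolded \<zeta>_def] \<zeta>_def)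
  have 3: "ev tensor_scale l (subst_neg_D2 sQ (pCons 0)
        (poly_tensor_left sQ (cR (pCons 0) br q) ?T)) (eval_at x f) (eval_at y g)
      = y * \<Delta>\<^sub>A a g \<xi> - (- l - y) * \<delta>\<^sub>A a \<xi> g + ((- l - y) * \<Delta>\<^sub>A a \<xi> g - y * \<delta>\<^sub>A a g \<xi>)"
    unfolding substitutions_at(3)[OF tensor_poly_operators(1)[OF T] f g] operators_at(1)[OF T f g]
      arith b[symmetric] T_apply
    by (simp add: \<alpha>_p[OF lin(3) g, unfolded \<xi>_def] \<alpha>_p[OF g lin(3), unfolded \<xi>_def] \<xi>_def)
  have 4: "ev tensor_scale l (poly_tensor_right sQ (cL br p) (\<alpha> q)) (eval_at x f) (eval_at y g)
      = x * \<Delta>\<^sub>A b f \<kappa> - (l + y) * \<delta>\<^sub>A b \<kappa> f"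
    unfolding operators_at(4)[OF \<alpha>_space f g] a[symmetric]
    by (simp add: \<alpha>_q[OF f lin(4), unfolded \<kappa>_def] \<kappa>_def)
  have 5: "ev tensor_scale l (poly_tensor_left sQ (cL br p) (\<alpha> q)) (eval_at x f) (eval_at y g)
      = (l + x) * \<Delta>\<^sub>A b \<kappa>' g - y * \<delta>\<^sub>A b g \<kappa>'"
    unfolding operators_at(3)[OF \<alpha>_space f g] a[symmetric]
    by (simp add: \<alpha>_q[OF lin(5) g, unfolded \<kappa>'_def] \<kappa>'_def)
  show ?thesis
    unfolding linear_add[OF linear_ev[OF vector_space_tensor_scale]]
      linear_minus[OF linear_ev[OF vector_space_tensor_scale]] plus_fun_apply fun_diff_def
      lhs 1 2 3 4 5
    unfolding \<eta>_def \<zeta>_def \<xi>_def \<kappa>_def \<kappa>'_def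
    by (simp add: defect_apply_simps f g) (simp add: algebra_simps)
qed

lemma compat2_iff:
  "(\<forall>p q. map_poly \<alpha> (br p q)
     = subst_neg_D2 sQ (pCons 0) (poly_tensor_right sQ (cR (pCons 0) br q) (flip (\<alpha> p) + \<alpha> p))
     - subst_neg_D2 sQ (pCons 0) (poly_tensor_left sQ (cL br q) (flip (\<alpha> p) + \<alpha> p))
     - subst_neg_D2 sQ (pCons 0) (poly_tensor_left sQ (cR (pCons 0) br q) (flip (\<alpha> p) + \<alpha> p))
     + poly_tensor_right sQ (cL br p) (\<alpha> q)
     + poly_tensor_left sQ (cL br p) (\<alpha> q))
    \<longleftrightarrow> (\<forall>a b. defect4 a b = 0 \<and> defect5 a b = 0 \<and> defect6 a b = 0
      \<and> defect7 a b = 0 \<and> defect8 a b = 0 \<and> defect9 a b = 0)"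
  (is "(\<forall>p q. ?L p q = ?R p q) \<longleftrightarrow> ?defects")
proof
  assume "\<forall>p q. ?L p q = ?R p q"
  then have eq: "(x + y + l) * (x * defect6 b a f g - y * defect4 b a g f - l * defect8 a b g f)
      - x * y * defect9 b a f g + x * l * defect7 a b f g - y * l * defect5 a b g f = 0"
    if "functional f" "functional g" for a b f g x y l
    using compat2_at[OF that, where p = "[:a:]" and q = "[:b:]" and l = l and x = x and y = y and a = a
        and b = b] by (simp add: ev_const)
  have 6: "defect6 a b f g = 0" if "functional f" "functional g" for a b f g
    using eq[OF that, of 1 0 0 a b] by simp
  have 4: "defect4 a b f g = 0" if "functional f" "functional g" for a b f g
    using eq[OF that(2,1), of 0 1 0 a b] by simp
  have 8: "defect8 a b f g = 0" if "functional f" "functional g" for a b f g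
    using eq[OF that(2,1), of 0 0 1 b a] by simp
  have 9: "defect9 a b f g = 0" if "functional f" "functional g" for a b f g
    using eq[OF that, of 1 1 0 a b] by (simp add: 4 6 that)
  have 7: "defect7 a b f g = 0" if "functional f" "functional g" for a b f g
    using eq[OF that, of 1 0 1 b a] by (simp add: 6 8 that)
  have 5: "defect5 a b f g = 0" if "functional f" "functional g" for a b f g
    using eq[OF that(2,1), of 0 1 1 b a] by (simp add: 4 8 that)
  show ?defects
    by (intro allI conjI; rule defect_eq_0I) (use 4 5 6 7 8 9 in auto)
next
  assume 0: ?defects
  show "\<forall>p q. ?L p q = ?R p q"
  proof (intro allI poly_of_tensors_eqI[OF vs])
    fix p q
    show "tensor_poly sQ (?L p q)"
      by (simp add: tensor_poly_def coeff_map_poly linear_at_0[OF linear_\<alpha>])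
    have T: "flip (\<alpha> p) + \<alpha> p \<in> tensor_space sQ"
      by (intro tensor_space_closed tensor_space_flip) simp_all
    show "tensor_poly sQ (?R p q)"
      by (intro tensor_poly_closed tensor_poly_operators T \<alpha>_space
          substitutions_at(6)[OF _ linear_functional_0[OF vs] linear_functional_0[OF vs]])
    show "ev tensor_scale l (?L p q) (eval_at x f) (eval_at y g)
        = ev tensor_scale l (?R p q) (eval_at x f) (eval_at y g)"
      if "functional f" "functional g" for f g x y l
      using compat2_at[OF that refl refl, where l = l and p = p and q = q and x = x and y = y] 0 by simp
  qed
qed

lemma leibniz_conformal_bialgebra_iff:
  "leibniz_conformal_bialgebra sQ (pCons 0) br \<alpha> \<longleftrightarrow> novikov_bidialgebra s ld rd \<delta>\<^sub>A \<Delta>\<^sub>A"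
  unfolding leibniz_conformal_bialgebra_def leibniz_conformal_bialgebra_axioms_def
    novikov_bidialgebra_iff coalgebra_iff compat1_iff[symmetric] compat2_iff[symmetric]
  using leibniz_conformal_algebra_bracket by blast

end

theorem theorem5p4:
  fixes s :: "'k::field_char_0 \<Rightarrow> 'a::ab_group_add \<Rightarrow> 'a"
    and Basis :: "'a set"
    and ld rd :: "'a \<Rightarrow> 'a \<Rightarrow> 'a"
    and \<delta> \<Delta> \<alpha> :: "'a poly \<Rightarrow> ('k, 'a poly) tensor2"
  assumes "finite_dimensional_vector_space s Basis"
    and "novikov_dialgebra s ld rd"
    and "D_hom_to_square (poly_scale s) (pCons 0) \<delta>"
    and "D_hom_to_square (poly_scale s) (pCons 0) \<Delta>"
    and "\<And>a. \<delta> [:a:] \<in> square_incl s ` tensor_space s"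
    and "\<And>a. \<Delta> [:a:] \<in> square_incl s ` tensor_space s"
    and "D_hom_to_square (poly_scale s) (pCons 0) \<alpha>"
    and "\<And>a. \<alpha> [:a:] = tensor_map (poly_scale s) (pCons 0) id (\<Delta> [:a:])
           - flip (tensor_map (poly_scale s) (pCons 0) id (\<delta> [:a:]))"
  shows "leibniz_conformal_bialgebra (poly_scale s) (pCons 0) (dialgebra_bracket ld rd) \<alpha>
    \<longleftrightarrow> novikov_bidialgebra s ld rd (restrict_to_A s \<delta>) (restrict_to_A s \<Delta>)"
proof (rule lifted_coproducts.leibniz_conformal_bialgebra_iff)
  show "lifted_coproducts s ld rd \<delta> \<Delta> \<alpha>"
    using assms(2-)
    by (simp add: lifted_coproducts_def lifted_coproducts_axioms_def novikov_dialgebra_char_0_def)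
qed

end
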